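(* In the setting described in the context, let $\{(z_i^k,s_j^k)_{i\in[n-1],j\in[m]}\}_{k\in\mathbb N}$ be generated by the relaxed scheme. Let $\tau_j>0$ ($j\in[m]$) be arbitrary, $\bar\tau_i=\sum_{j\in\mathcal J_{c,i}}\tau_j$ and $1/\bar\beta_i=\sum_{l\in\mathcal P_i}1/\beta_l$ for $i\in[n-1]$ (empty sums are $0$). Assume that for all $i\in[n-1]$, $j\in[m]$: (a) $\theta_i,\zeta_j\in(0,2)$; (b) $M_i\succeq\alpha_iI$ with $\alpha_i>\frac1{2-\theta_i}\big(2\bar\tau_i+\frac1{2\bar\beta_i}\big)$; (c) $N_j\succeq\sigma_jI$ with $\sigma_j>\frac1{2-\zeta_j}\big(\frac{\|L_j\|^2}{2\tau_j}+\frac1{2\nu_j}\big)$. Then $\sum_{i=1}^{n-1}\frac1{\theta_i}\|z_i^k-z_i^{k+1}\|_{M_i}^2+\sum_{j=1}^m\frac1{\zeta_j}\|s_j^k-s_j^{k+1}\|_{N_j}^2=o(1/k)$ as $k\to\infty$. More specifically, for every $(z_i^\star,s_j^\star)_{i,j}\in\mathrm{Fix}\,\mathcal T_{zs,\theta,\zeta}$ and every integer $k\ge1$, $$\sum_{i=1}^{n-1}\frac1{\theta_i}\|z_i^k-z_i^{k+1}\|_{M_i}^2+\sum_{j=1}^m\frac1{\zeta_j}\|s_j^k-s_j^{k+1}\|_{N_j}^2\le\frac1{k(\xi-1)}\Big(\sum_{i=1}^{n-1}\frac1{\theta_i}\|z_i^0-z_i^\star\|_{M_i}^2+\sum_{j=1}^m\frac1{\zeta_j}\|s_j^0-s_j^\star\|_{N_j}^2\Big),$$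 where $$\xi=\min_{i\in[n-1],\,j\in[m]}\Big\{\tfrac2{\theta_i}\Big(1-\tfrac1{\alpha_i}\big(\bar\tau_i+\tfrac1{4\bar\beta_i}\big)\Big),\ \tfrac2{\zeta_j}\Big(1-\tfrac1{\sigma_j}\big(\tfrac{\|L_j\|^2}{4\tau_j}+\tfrac1{4\nu_j}\big)\Big)\Big\}.$$
   Context: Notation: $[r]=\{1,\dots,r\}$; $\|x\|_W^2=\langle x|Wx\rangle$ for bounded self-adjoint $W$. Problem data: $n\ge2$ and $m,p\ge0$ are integers; $\mathcal H,\mathcal K_1,\dots,\mathcal K_m$ are real Hilbert spaces; $A_i:\mathcal H\to2^{\mathcal H}$ ($i=0,\dots,n-1$) and $B_j:\mathcal K_j\to2^{\mathcal K_j}$ are maximally monotone; $D_j:\mathcal K_j\to2^{\mathcal K_j}$ is maximally monotone and $\nu_j$-strongly monotone, $\nu_j>0$ (so $D_j^{-1}$ is single-valued and $\nu_j$-cocoercive; if $D_j$ is the normal cone operator of $\{0\}$, then $D_j^{-1}=0$ and one puts $\nu_j=+\infty$, $1/\nu_j=0$); $C_l:\mathcal H\to\mathcal H$ ($l\in[p]$) is $\beta_l$-cocoercive, $\beta_l>0$; $L_j:\mathcal H\to\mathcal K_j$ is bounded linear; $a\in\mathcal H$, $b_j\in\mathcal K_j$. Problem (P): find $u\in\mathcal H$ with $a\in\sum_{i=0}^{n-1}A_iu+\sum_{j=1}^mL_j^*(B_j\square D_j)(L_ju-b_j)+\sum_{l=1}^pC_lu$, where $B\square D=(B^{-1}+D^{-1})^{-1}$.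 Standing assumption: (P) has at least one solution. Tree data: an arbitrary rooted tree with node set $\{0,\dots,n-1\}$ and root $0$; $\mathrm{pa}(i)$ is the parent of $i\in[n-1]$, $\mathrm{ch}(i)$ the set of children of $i$. $(\mathcal J_i)_{i=0}^{n-1}$ is a partition of $[m]$ (empty cells allowed) with $\mathcal J_i=\varnothing$ for every leaf $i$. $(\mathcal P_i)_{i=0}^{n-1}$ is a partition of $[p]$ (empty cells allowed) with $\mathcal P_0=\varnothing$. For each non-leaf node $r$, $(\mathcal J_{c,i})_{i\in\mathrm{ch}(r)}$ is a partition (empty cells allowed) of $\mathcal J_r$. Metrics: $M_i$ on $\mathcal H$ ($i\in[n-1]$) and $N_j$ on $\mathcal K_j$ ($j\in[m]$) are linear, bounded, self-adjoint, uniformly positive definite. Prediction map: given $(z,s)=((z_i)_{i\in[n-1]},(s_j)_{j\in[m]})$, compute from root to leaves (root) $0\in A_0u_0+\sum_{c\in\mathrm{ch}(0)}M_c(u_0-z_c)+\sum_{j\in\mathcal J_0}L_j^*s_j-a$; (duals, for each node $i$ and $j\in\mathcal J_i$) $0\in B_j^{-1}\tilde s_j+N_j(\tilde s_j-s_j)+D_j^{-1}s_j-L_ju_i+b_j$; (nodes $i\in[n-1]$) $0\in A_iu_i+M_i(u_i+z_i-2u_{\mathrm{pa}(i)})+\sum_{c\in\mathrm{ch}(i)}M_c(u_i-z_c)+\sum_{l\in\mathcal P_i}C_lu_{\mathrm{pa}(i)}+\sum_{j\in\mathcal J_i}L_j^*s_j+\sum_{j\in\mathcal J_{c,i}}L_j^*(\tilde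 s_j-s_j)$; $\tilde z_i=z_i+u_i-u_{\mathrm{pa}(i)}$. Relaxed scheme: $\mathcal T_{zs,\theta,\zeta}(z,s)=(z^+,s^+)$ with $z_i^+=z_i+\theta_i(\tilde z_i-z_i)$, $s_j^+=s_j+\zeta_j(\tilde s_j-s_j)$; $(z^{k+1},s^{k+1})=\mathcal T_{zs,\theta,\zeta}(z^k,s^k)$ from arbitrary $(z^0,s^0)$. *)

theory Defs
  imports
    "HOL-Analysis.Analysis"
    "HOL-Library.Set_Algebras"
    "HOL-Library.Disjoint_Sets"
    "HOL-Library.Landau_Symbols"
begin

text \<open>
  Sums of sets are Minkowski sums (\<open>Set_Algebras\<close>); the empty sum is \<open>{0}\<close>.

  The ambient space \<open>\<H>\<close> is a type. The finitely many, possibly different, Hilbert spaces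
  \<open>\<K>\<^sub>j\<close> are closed subspaces \<open>K j\<close> of one Hilbert space type; every finite family of
  Hilbert spaces arises in this way, e.g. inside its direct sum. Hence the notions below
  are relative to a subspace \<open>K\<close>. A set-valued operator \<open>K \<rightarrow> 2\<^sup>K\<close> is a function
  \<open>A :: 'a \<Rightarrow> 'a set\<close> whose graph is contained in \<open>K \<times> K\<close>, i.e. with empty values outside \<open>K\<close>.
\<close>

subsection \<open>Set-valued operators\<close>

definition graph_of :: "('a \<Rightarrow> 'b set) \<Rightarrow> ('a \<times> 'b) set" where
  "graph_of A = {(x, v). v \<in> A x}"

definition op_inverse :: "('a \<Rightarrow> 'b set) \<Rightarrow> 'b \<Rightarrow> 'a set" where
  "op_inverse A v = {x. v \<in> A x}"

definition monotone_operator :: "('a::real_inner \<Rightarrow> 'a set) \<Rightarrow> bool" where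
  "monotone_operator A \<longleftrightarrow>
     (\<forall>x y. \<forall>v\<in>A x. \<forall>w\<in>A y. 0 \<le> (x - y) \<bullet> (v - w))"

definition maximally_monotone_on :: "'a::real_inner set \<Rightarrow> ('a \<Rightarrow> 'a set) \<Rightarrow> bool" where
  "maximally_monotone_on K A \<longleftrightarrow>
     graph_of A \<subseteq> K \<times> K \<and> monotone_operator A \<and>
     (\<forall>A'. graph_of A' \<subseteq> K \<times> K \<longrightarrow> monotone_operator A' \<longrightarrow>
        graph_of A \<subseteq> graph_of A' \<longrightarrow> graph_of A' = graph_of A)"

definition strongly_monotone :: "real \<Rightarrow> ('a::real_inner \<Rightarrow> 'a set) \<Rightarrow> bool" where
  "strongly_monotone \<nu> A \<longleftrightarrow>
     (\<forall>x y. \<forall>v\<in>A x. \<forall>w\<in>A y. \<nu> * (norm (x - y))\<^sup>2 \<le> (x - y) \<bullet> (v - w))"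

definition cocoercive :: "real \<Rightarrow> ('a::real_inner \<Rightarrow> 'a) \<Rightarrow> bool" where
  "cocoercive \<beta> C \<longleftrightarrow> (\<forall>x y. \<beta> * (norm (C x - C y))\<^sup>2 \<le> (x - y) \<bullet> (C x - C y))"

definition normal_cone_on :: "'a::real_inner set \<Rightarrow> 'a set \<Rightarrow> 'a \<Rightarrow> 'a set" where
  "normal_cone_on K S x = (if x \<in> S then {v\<in>K. \<forall>y\<in>S. (y - x) \<bullet> v \<le> 0} else {})"

text \<open>
  \<open>\<nu> = \<infinity>\<close> is the convention for the normal cone operator of \<open>{0}\<close>, whose inverse is
  the zero operator.
\<close>

definition strong_monotonicity_constant ::
    "'a::real_inner set \<Rightarrow> ereal \<Rightarrow> ('a \<Rightarrow> 'a set) \<Rightarrow> bool" where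
  "strong_monotonicity_constant K \<nu> D \<longleftrightarrow>
     0 < \<nu> \<and>
     (if \<nu> = \<infinity> then D = normal_cone_on K {0} else strongly_monotone (real_of_ereal \<nu>) D)"

definition parallel_sum :: "('a \<Rightarrow> 'b::plus set) \<Rightarrow> ('a::plus \<Rightarrow> 'b set) \<Rightarrow> 'a \<Rightarrow> 'b set" where
  "parallel_sum B D = op_inverse (\<lambda>v. op_inverse B v + op_inverse D v)"

subsection \<open>Metrics\<close>

definition metric_operator_on :: "'a::real_inner set \<Rightarrow> ('a \<Rightarrow> 'a) \<Rightarrow> bool" where
  "metric_operator_on K W \<longleftrightarrow>
     (\<forall>x\<in>K. W x \<in> K) \<and>
     (\<forall>x\<in>K. \<forall>y\<in>K. W (x + y) = W x + W y) \<and>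
     (\<forall>x\<in>K. \<forall>r. W (r *\<^sub>R x) = r *\<^sub>R W x) \<and>
     (\<exists>c. \<forall>x\<in>K. norm (W x) \<le> c * norm x) \<and>
     (\<forall>x\<in>K. \<forall>y\<in>K. W x \<bullet> y = x \<bullet> W y) \<and>
     (\<exists>c>0. \<forall>x\<in>K. c * (norm x)\<^sup>2 \<le> x \<bullet> W x)"

text \<open>The relation \<open>W \<succeq> \<alpha> I\<close> on \<open>K\<close>.\<close>

definition loewner_ge_on :: "'a::real_inner set \<Rightarrow> ('a \<Rightarrow> 'a) \<Rightarrow> real \<Rightarrow> bool" where
  "loewner_ge_on K W \<alpha> \<longleftrightarrow> (\<forall>x\<in>K. 0 \<le> x \<bullet> (W x - \<alpha> *\<^sub>R x))"

definition wnorm_sq :: "('a::real_inner \<Rightarrow> 'a) \<Rightarrow> 'a \<Rightarrow> real" where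
  "wnorm_sq W x = x \<bullet> W x"

subsection \<open>Trees and partitions\<close>

text \<open>
  A rooted tree on the nodes \<open>{0..<n}\<close> with root \<open>0\<close>, given by its parent function: iterating
  \<open>pa\<close> from any node leads to the root. The value \<open>pa 0\<close> is irrelevant.
\<close>

definition rooted_tree :: "nat \<Rightarrow> (nat \<Rightarrow> nat) \<Rightarrow> bool" where
  "rooted_tree n pa \<longleftrightarrow> (\<forall>i\<in>{1..<n}. pa i < n \<and> (\<exists>k. (pa ^^ k) i = 0))"

definition children :: "nat \<Rightarrow> (nat \<Rightarrow> nat) \<Rightarrow> nat \<Rightarrow> nat set" where
  "children n pa i = {c\<in>{1..<n}. pa c = i}"

definition indexed_partition :: "'i set \<Rightarrow> ('i \<Rightarrow> 'b set) \<Rightarrow> 'b set \<Rightarrow> bool" where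
  "indexed_partition I F X \<longleftrightarrow> disjoint_family_on F I \<and> (\<Union>i\<in>I. F i) = X"

subsection \<open>The monotone inclusion and the relaxed scheme\<close>

definition solves_inclusion ::
    "nat \<Rightarrow> nat \<Rightarrow> nat \<Rightarrow>
     (nat \<Rightarrow> 'h \<Rightarrow> 'h set) \<Rightarrow> (nat \<Rightarrow> 'k \<Rightarrow> 'k set) \<Rightarrow> (nat \<Rightarrow> 'k \<Rightarrow> 'k set) \<Rightarrow> (nat \<Rightarrow> 'h \<Rightarrow> 'h) \<Rightarrow>
     (nat \<Rightarrow> 'h::real_inner \<Rightarrow> 'k::real_inner) \<Rightarrow> 'h \<Rightarrow> (nat \<Rightarrow> 'k) \<Rightarrow> 'h \<Rightarrow> bool" where
  "solves_inclusion n m p A B D C L a b u \<longleftrightarrow>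
     a \<in> (\<Sum>i<n. A i u)
       + (\<Sum>j\<in>{1..m}. adjoint (L j) ` parallel_sum (B j) (D j) (L j u - b j))
       + {\<Sum>l\<in>{1..p}. C l u}"

text \<open>
  \<open>prediction \<dots> z s u zt st\<close>: the points \<open>u\<close>, \<open>zt\<close> (\<open>z\<close> tilde) and \<open>st\<close> (\<open>s\<close> tilde) satisfy
  all the inclusions of the prediction map at \<open>(z, s)\<close>. Each inclusion is the resolvent
  equation of a maximally monotone operator in a uniformly positive definite metric, so this
  relation is the graph of a total function on the components with indices in range.
\<close>

definition prediction ::
    "nat \<Rightarrow> (nat \<Rightarrow> nat) \<Rightarrow> (nat \<Rightarrow> nat set) \<Rightarrow> (nat \<Rightarrow> nat set) \<Rightarrow> (nat \<Rightarrow> nat set) \<Rightarrow>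
     (nat \<Rightarrow> 'h \<Rightarrow> 'h set) \<Rightarrow> (nat \<Rightarrow> 'k \<Rightarrow> 'k set) \<Rightarrow> (nat \<Rightarrow> 'k \<Rightarrow> 'k set) \<Rightarrow> (nat \<Rightarrow> 'h \<Rightarrow> 'h) \<Rightarrow>
     (nat \<Rightarrow> 'h::real_inner \<Rightarrow> 'k::real_inner) \<Rightarrow> 'h \<Rightarrow> (nat \<Rightarrow> 'k) \<Rightarrow>
     (nat \<Rightarrow> 'h \<Rightarrow> 'h) \<Rightarrow> (nat \<Rightarrow> 'k \<Rightarrow> 'k) \<Rightarrow>
     (nat \<Rightarrow> 'h) \<Rightarrow> (nat \<Rightarrow> 'k) \<Rightarrow> (nat \<Rightarrow> 'h) \<Rightarrow> (nat \<Rightarrow> 'h) \<Rightarrow> (nat \<Rightarrow> 'k) \<Rightarrow> bool" where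
  "prediction n pa J P Jc A B D C L a b M N z s u zt st \<longleftrightarrow>
     0 \<in> A 0 (u 0)
         + {(\<Sum>c\<in>children n pa 0. M c (u 0 - z c)) + (\<Sum>j\<in>J 0. adjoint (L j) (s j)) - a} \<and>
     (\<forall>i<n. \<forall>j\<in>J i.
        0 \<in> op_inverse (B j) (st j) + {N j (st j - s j)} + op_inverse (D j) (s j)
            + {b j - L j (u i)}) \<and>
     (\<forall>i\<in>{1..<n}.
        0 \<in> A i (u i)
            + {M i (u i + z i - 2 *\<^sub>R u (pa i))
               + (\<Sum>c\<in>children n pa i. M c (u i - z c))
               + (\<Sum>l\<in>P i. C l (u (pa i)))
               + (\<Sum>j\<in>J i. adjoint (L j) (s j))
               + (\<Sum>j\<in>Jc i. adjoint (L j) (st j - s j))}) \<and>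
     (\<forall>i\<in>{1..<n}. zt i = z i + u i - u (pa i))"

text \<open>
  \<open>relaxed_step \<dots> (z, s) (z', s')\<close>: the relaxed map sends \<open>(z, s)\<close> to \<open>(z', s')\<close>. Only the
  components \<open>z i\<close> with \<open>1 \<le> i < n\<close> and \<open>s j\<close> with \<open>1 \<le> j \<le> m\<close> are constrained.
\<close>

definition relaxed_step ::
    "nat \<Rightarrow> nat \<Rightarrow> (nat \<Rightarrow> nat) \<Rightarrow> (nat \<Rightarrow> nat set) \<Rightarrow> (nat \<Rightarrow> nat set) \<Rightarrow> (nat \<Rightarrow> nat set) \<Rightarrow>
     (nat \<Rightarrow> 'k set) \<Rightarrow>
     (nat \<Rightarrow> 'h \<Rightarrow> 'h set) \<Rightarrow> (nat \<Rightarrow> 'k \<Rightarrow> 'k set) \<Rightarrow> (nat \<Rightarrow> 'k \<Rightarrow> 'k set) \<Rightarrow> (nat \<Rightarrow> 'h \<Rightarrow> 'h) \<Rightarrow>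
     (nat \<Rightarrow> 'h::real_inner \<Rightarrow> 'k::real_inner) \<Rightarrow> 'h \<Rightarrow> (nat \<Rightarrow> 'k) \<Rightarrow>
     (nat \<Rightarrow> 'h \<Rightarrow> 'h) \<Rightarrow> (nat \<Rightarrow> 'k \<Rightarrow> 'k) \<Rightarrow> (nat \<Rightarrow> real) \<Rightarrow> (nat \<Rightarrow> real) \<Rightarrow>
     (nat \<Rightarrow> 'h) \<times> (nat \<Rightarrow> 'k) \<Rightarrow> (nat \<Rightarrow> 'h) \<times> (nat \<Rightarrow> 'k) \<Rightarrow> bool" where
  "relaxed_step n m pa J P Jc K A B D C L a b M N \<theta> \<zeta> = (\<lambda>(z, s) (z', s').
     (\<forall>j\<in>{1..m}. s j \<in> K j) \<and>
     (\<exists>u zt st. prediction n pa J P Jc A B D C L a b M N z s u zt st \<and>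
        (\<forall>i\<in>{1..<n}. z' i = z i + \<theta> i *\<^sub>R (zt i - z i)) \<and>
        (\<forall>j\<in>{1..m}. s' j = s j + \<zeta> j *\<^sub>R (st j - s j))))"

definition relaxed_fix ::
    "nat \<Rightarrow> nat \<Rightarrow> (nat \<Rightarrow> nat) \<Rightarrow> (nat \<Rightarrow> nat set) \<Rightarrow> (nat \<Rightarrow> nat set) \<Rightarrow> (nat \<Rightarrow> nat set) \<Rightarrow>
     (nat \<Rightarrow> 'k set) \<Rightarrow>
     (nat \<Rightarrow> 'h \<Rightarrow> 'h set) \<Rightarrow> (nat \<Rightarrow> 'k \<Rightarrow> 'k set) \<Rightarrow> (nat \<Rightarrow> 'k \<Rightarrow> 'k set) \<Rightarrow> (nat \<Rightarrow> 'h \<Rightarrow> 'h) \<Rightarrow>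
     (nat \<Rightarrow> 'h::real_inner \<Rightarrow> 'k::real_inner) \<Rightarrow> 'h \<Rightarrow> (nat \<Rightarrow> 'k) \<Rightarrow>
     (nat \<Rightarrow> 'h \<Rightarrow> 'h) \<Rightarrow> (nat \<Rightarrow> 'k \<Rightarrow> 'k) \<Rightarrow> (nat \<Rightarrow> real) \<Rightarrow> (nat \<Rightarrow> real) \<Rightarrow>
     ((nat \<Rightarrow> 'h) \<times> (nat \<Rightarrow> 'k)) set" where
  "relaxed_fix n m pa J P Jc K A B D C L a b M N \<theta> \<zeta> =
     {x. relaxed_step n m pa J P Jc K A B D C L a b M N \<theta> \<zeta> x x}"

definition weighted_dist_sq ::
    "nat \<Rightarrow> nat \<Rightarrow> (nat \<Rightarrow> 'h \<Rightarrow> 'h) \<Rightarrow> (nat \<Rightarrow> 'k \<Rightarrow> 'k) \<Rightarrow> (nat \<Rightarrow> real) \<Rightarrow> (nat \<Rightarrow> real) \<Rightarrow>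
     (nat \<Rightarrow> 'h::real_inner) \<times> (nat \<Rightarrow> 'k::real_inner) \<Rightarrow> (nat \<Rightarrow> 'h) \<times> (nat \<Rightarrow> 'k) \<Rightarrow> real" where
  "weighted_dist_sq n m M N \<theta> \<zeta> = (\<lambda>(z, s) (z', s').
     (\<Sum>i\<in>{1..<n}. 1 / \<theta> i * wnorm_sq (M i) (z i - z' i)) +
     (\<Sum>j\<in>{1..m}. 1 / \<zeta> j * wnorm_sq (N j) (s j - s' j)))"

end

theory Submission
  imports Defs
begin

text \<open>
  Write \<open>\<Delta>\<close> for the difference of two runs, \<open>d\<^sub>i = \<Delta>(z\<^sub>i - zt\<^sub>i) = \<Delta>(u\<^bsub>pa i\<^esub> - u\<^sub>i)\<close> and
  \<open>e\<^sub>j = \<Delta>(s\<^sub>j - st\<^sub>j)\<close>. Adding the monotonicity inequalities of all \<open>A\<^sub>i\<close> and \<open>B\<^sub>j\<close>, the terms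
  collect edge by edge along the tree: the metric terms of the edge from \<open>pa i\<close> to \<open>i\<close> combine to
  \<open>\<langle>\<Delta>zt\<^sub>i, M\<^sub>i d\<^sub>i\<rangle>\<close>, and each dual index \<open>j\<close> in \<open>Jc i\<close> contributes \<open>\<langle>\<Delta>st\<^sub>j, N\<^sub>j e\<^sub>j\<rangle> - \<langle>L\<^sub>j d\<^sub>i, e\<^sub>j\<rangle>\<close>.
  Young's inequality bounds the coupling terms, the cocoercive \<open>C\<^sub>l\<close> and the cocoercive inverses
  of the \<open>D\<^sub>j\<close> by multiples of \<open>|d\<^sub>i|\<^sup>2\<close> and \<open>|e\<^sub>j|\<^sup>2\<close>. Hence, in the metric of \<open>weighted_dist_sq\<close>,
  \<open>|Tx - Ty|\<^sup>2 + (\<xi> - 1) |(x - Tx) - (y - Ty)|\<^sup>2 \<le> |x - y|\<^sup>2\<close> with \<open>\<xi> > 1\<close>.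
  Applied to consecutive iterates this makes the residuals nonincreasing, applied to an iterate
  and a fixed point it makes them summable; together these give both rates. A fixed point is
  built from a solution of the inclusion by solving for \<open>z\<close> from the leaves to the root.
\<close>

section \<open>Rates for nonincreasing summable sequences\<close>

text \<open>A block of \<open>f\<close> from \<open>N\<close> up to \<open>k\<close> has a small sum
  by the Cauchy criterion, while monotonicity bounds this sum below by
  \<open>(k - N) * f k\<close>.\<close>

lemma summable_decseq_smallo:
  fixes f :: "nat \<Rightarrow> real"
  assumes nonneg: "\<And>k. 0 \<le> f k" and dec: "decseq f" and sum: "summable f"
  shows "f \<in> o(\<lambda>k. 1 / real k)"
proof (rule smalloI_tendsto)
  have "(\<lambda>k. real k * f k) \<longlonglongrightarrow> 0"
  proof (rule LIMSEQ_I)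
    fix e :: real assume "0 < e"
    then obtain N where N: "\<And>m n. m \<ge> N \<Longrightarrow> norm (sum f {m..<n}) < e / 2"
      using sum unfolding summable_Cauchy by (meson half_gt_zero)
    have "norm (real k * f k - 0) < e" if k: "k \<ge> 2 * N" for k
    proof -
      have "real (k - N) * f k = (\<Sum>i\<in>{N..<k}. f k)" by simp
      also have "\<dots> \<le> sum f {N..<k}"
        by (intro sum_mono) (use dec in \<open>auto simp: decseq_def\<close>)
      also have "\<dots> < e / 2" using N[of N k] by simp
      finally have *: "real (k - N) * f k < e / 2" .
      \<comment> \<open>For \<open>k \<ge> 2 * N\<close> the block has at least half the length
        \<open>k\<close>, so its bound \<open>e / 2\<close> suffices.\<close>
      have "real k * f k \<le> (2 * real (k - N)) * f k"
        by (intro mult_right_mono nonneg) (use k in \<open>simp add: of_nat_diff\<close>)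
      with * show ?thesis using nonneg[of k] by simp
    qed
    then show "\<exists>K. \<forall>k\<ge>K. norm (real k * f k - 0) < e" by blast
  qed
  then show "(\<lambda>k. f k / (1 / real k)) \<longlonglongrightarrow> 0" by (simp add: mult.commute)
  show "\<forall>\<^sub>F k in sequentially. 1 / real k \<noteq> 0"
    using eventually_gt_at_top[of 0] by eventually_elim simp
qed

text \<open>Telescoping. In the application \<open>V k\<close> is the squared distance of the
  iterate to a fixed point, \<open>f k\<close> the squared residual and \<kappa> is
  \<open>\<xi> - 1\<close>.\<close>

lemma fejer_sum_le:
  fixes f V :: "nat \<Rightarrow> real"
  assumes V: "\<And>k. 0 \<le> V k" and descent: "\<And>k. V (Suc k) + \<kappa> * f k \<le> V k"
  shows "\<kappa> * sum f {..<k} \<le> V 0"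
proof -
  have "V k + \<kappa> * sum f {..<k} \<le> V 0"
  proof (induction k)
    case (Suc k)
    then show ?case using descent[of k] by (simp add: algebra_simps)
  qed simp
  with V[of k] show ?thesis by linarith
qed

text \<open>As \<open>f\<close> is nonincreasing, \<open>f k\<close> is at most the mean of the
  \<open>k\<close> terms before it, and the telescoped descent bounds their sum.\<close>

lemma fejer_rate:
  fixes f V :: "nat \<Rightarrow> real"
  assumes dec: "decseq f" and \<kappa>: "0 < \<kappa>"
    and V: "\<And>k. 0 \<le> V k" and descent: "\<And>k. V (Suc k) + \<kappa> * f k \<le> V k" and k: "k \<ge> 1"
  shows "f k \<le> 1 / (real k * \<kappa>) * V 0"
proof -
  have "real k * f k = (\<Sum>i<k. f k)" by simp
  also have "\<dots> \<le> sum f {..<k}" by (intro sum_mono) (use dec in \<open>auto simp: decseq_def\<close>)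
  finally have "\<kappa> * (real k * f k) \<le> \<kappa> * sum f {..<k}" using \<kappa> by simp
  also have "\<dots> \<le> V 0" by (rule fejer_sum_le[where V = V, OF V descent])
  finally show ?thesis using \<kappa> k by (simp add: field_simps)
qed

lemma fejer_summable:
  fixes f V :: "nat \<Rightarrow> real"
  assumes f: "\<And>k. 0 \<le> f k" and \<kappa>: "0 < \<kappa>"
    and V: "\<And>k. 0 \<le> V k" and descent: "\<And>k. V (Suc k) + \<kappa> * f k \<le> V k"
  shows "summable f"
proof (rule summableI_nonneg_bounded[OF f])
  show "sum f {..<k} \<le> V 0 / \<kappa>" for k
    using fejer_sum_le[of V \<kappa> f k, OF V descent] \<kappa> by (simp add: field_simps)
qed

section \<open>Metric operators, Riesz representation and the adjoint\<close>

lemma metric_operator_on_add: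
  "metric_operator_on K W \<Longrightarrow> x \<in> K \<Longrightarrow> y \<in> K \<Longrightarrow> W (x + y) = W x + W y"
  by (simp add: metric_operator_on_def)

lemma metric_operator_on_scaleR:
  "metric_operator_on K W \<Longrightarrow> x \<in> K \<Longrightarrow> W (r *\<^sub>R x) = r *\<^sub>R W x"
  by (simp add: metric_operator_on_def)

lemma metric_operator_on_symmetric:
  "metric_operator_on K W \<Longrightarrow> x \<in> K \<Longrightarrow> y \<in> K \<Longrightarrow> W x \<bullet> y = x \<bullet> W y"
  by (simp add: metric_operator_on_def)

lemma metric_operator_on_diff:
  assumes "metric_operator_on K W" "subspace K" "x \<in> K" "y \<in> K"
  shows "W (x - y) = W x - W y"
  using metric_operator_on_add[OF assms(1), of "x - y" y] assms subspace_diff[of K x y] by simp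

lemma metric_operator_on_zero: "metric_operator_on K W \<Longrightarrow> subspace K \<Longrightarrow> W 0 = 0"
  using metric_operator_on_diff[of K W 0 0] subspace_0 by force

lemma wnorm_sq_nonneg:
  assumes "metric_operator_on K W" "x \<in> K" shows "0 \<le> wnorm_sq W x"
proof -
  obtain c where "c > 0" "\<forall>x\<in>K. c * (norm x)\<^sup>2 \<le> x \<bullet> W x"
    using assms(1) unfolding metric_operator_on_def by blast
  then show ?thesis
    using assms(2) unfolding wnorm_sq_def
    by (meson mult_nonneg_nonneg less_imp_le order_trans zero_le_power2)
qed

lemma wnorm_sq_add:
  assumes "metric_operator_on K W" "x \<in> K" "y \<in> K"
  shows "wnorm_sq W (x + y) = wnorm_sq W x + 2 * (x \<bullet> W y) + wnorm_sq W y"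
  using metric_operator_on_add[OF assms] metric_operator_on_symmetric[OF assms]
  by (simp add: wnorm_sq_def inner_add inner_commute[of y "W x"])

lemma wnorm_sq_scaleR:
  assumes "metric_operator_on K W" "x \<in> K"
  shows "wnorm_sq W (r *\<^sub>R x) = r\<^sup>2 * wnorm_sq W x"
  using metric_operator_on_scaleR[OF assms] by (simp add: wnorm_sq_def power2_eq_square)

lemma metric_operator_id: "metric_operator_on UNIV (\<lambda>x. x)"
  unfolding metric_operator_on_def
  by (auto simp: power2_norm_eq_inner intro!: exI[of _ 1])

text \<open>
  The representer minimizes \<open>\<langle>x, W x\<rangle> / 2 - f x\<close>; by the parallelogram identity every minimizing
  sequence is Cauchy. With \<open>W\<close> the identity this is the Riesz representation theorem.
\<close>

lemma metric_operator_representer: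
  fixes W :: "'a::{real_inner, complete_space} \<Rightarrow> 'a" and f :: "'a \<Rightarrow> real"
  assumes W: "metric_operator_on UNIV W" and f: "bounded_linear f"
  shows "\<exists>x. \<forall>h. W x \<bullet> h = f h"
proof -
  interpret f: bounded_linear f by fact
  obtain c where c: "c > 0" and cW: "\<And>x. c * (norm x)\<^sup>2 \<le> wnorm_sq W x"
    using W unfolding metric_operator_on_def wnorm_sq_def by blast
  obtain k where k: "\<And>x. norm (W x) \<le> norm x * k"
    using W unfolding metric_operator_on_def by (metis UNIV_I mult.commute)
  have blW: "bounded_linear W"
    by (rule bounded_linear_intro[of _ k])
      (use k in \<open>simp_all add: metric_operator_on_add[OF W] metric_operator_on_scaleR[OF W]\<close>)
  define \<phi> where "\<phi> x = wnorm_sq W x / 2 - f x" for x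
  obtain k' where k': "\<And>x. norm (f x) \<le> norm x * k'" using f.bounded by blast
  \<comment> \<open>Completing the square in \<open>norm x\<close>: the quadratic part, at least
    \<open>c / 2\<close> times the squared norm, dominates the linear functional.\<close>
  have bdd: "- (k'\<^sup>2 / (2 * c)) \<le> \<phi> x" for x
  proof -
    have "0 \<le> (c * norm x - k')\<^sup>2 / (2 * c)" using c by simp
    also have "\<dots> = c * (norm x)\<^sup>2 / 2 - norm x * k' + k'\<^sup>2 / (2 * c)"
      using c by (simp add: power2_eq_square field_simps)
    finally show ?thesis using k'[of x] cW[of x] unfolding \<phi>_def by simp
  qed
  define I where "I = Inf (range \<phi>)"
  have bb: "bdd_below (range \<phi>)" using bdd by (auto intro!: bdd_belowI)
  have I: "I \<le> \<phi> x" for x unfolding I_def by (rule cInf_lower[OF _ bb]) simp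
  have "\<exists>x. \<phi> x < I + inverse (real (Suc n))" for n
    using cInf_less_iff[OF _ bb, of "I + inverse (real (Suc n))"] unfolding I_def by auto
  then obtain X where X: "\<And>n. \<phi> (X n) < I + inverse (real (Suc n))" by metis
  have par: "c / 4 * (norm (x - y))\<^sup>2 \<le> (\<phi> x - I) + (\<phi> y - I)" for x y
  proof -
    have 1: "wnorm_sq W (x + y) = wnorm_sq W x + 2 * (x \<bullet> W y) + wnorm_sq W y"
      by (rule wnorm_sq_add[OF W]) auto
    have 2: "wnorm_sq W (x - y) = wnorm_sq W x - 2 * (x \<bullet> W y) + wnorm_sq W y"
      using wnorm_sq_add[OF W, of x "- y"] wnorm_sq_scaleR[OF W, of y "-1"]
        metric_operator_on_scaleR[OF W, of y "-1"] by simp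
    have 3: "\<phi> ((1/2) *\<^sub>R (x + y)) = wnorm_sq W (x + y) / 8 - (f x + f y) / 2"
      unfolding \<phi>_def using wnorm_sq_scaleR[OF W, of "x + y" "1/2"]
      by (simp add: f.scaleR f.add power2_eq_square del: scaleR_half_double)
    have "2 * I \<le> 2 * \<phi> ((1/2) *\<^sub>R (x + y))" using I by simp
    also have "\<dots> = \<phi> x + \<phi> y - wnorm_sq W (x - y) / 4"
      unfolding 3 unfolding \<phi>_def 1 2 by (simp add: field_simps)
    finally show ?thesis using cW[of "x - y"] by simp
  qed
  have "Cauchy X"
  proof (rule metric_CauchyI)
    fix e :: real assume e: "0 < e"
    then have "0 < c / 8 * e\<^sup>2" using c by simp
    then obtain n0 where n0: "inverse (real (Suc n0)) < c / 8 * e\<^sup>2"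
      using reals_Archimedean by blast
    show "\<exists>N. \<forall>m\<ge>N. \<forall>n\<ge>N. dist (X m) (X n) < e"
    proof (intro exI allI impI)
      fix m n assume mn: "m \<ge> n0" "n \<ge> n0"
      have "inverse (real (Suc m)) \<le> inverse (real (Suc n0))" "inverse (real (Suc n)) \<le> inverse (real (Suc n0))"
        using mn by (auto intro!: le_imp_inverse_le)
      then have "c / 4 * (norm (X m - X n))\<^sup>2 < c / 4 * e\<^sup>2"
        using par[of "X m" "X n"] X[of m] X[of n] n0 by linarith
      then have "(norm (X m - X n))\<^sup>2 < e\<^sup>2" using c by simp
      then show "dist (X m) (X n) < e" using e by (simp add: dist_norm power_less_imp_less_base)
    qed
  qed
  then obtain x where x: "X \<longlonglongrightarrow> x" using Cauchy_convergent_iff convergent_def by blast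
  have "(\<lambda>n. \<phi> (X n)) \<longlonglongrightarrow> \<phi> x" unfolding \<phi>_def wnorm_sq_def
    by (intro tendsto_intros x bounded_linear.tendsto[OF blW] f.tendsto) simp_all
  moreover have "(\<lambda>n. I + inverse (real (Suc n))) \<longlonglongrightarrow> I + 0"
    by (intro tendsto_intros LIMSEQ_inverse_real_of_nat)
  ultimately have "\<phi> x \<le> I + 0"
    using X by (intro LIMSEQ_le) (auto intro: less_imp_le)
  then have min: "\<phi> x \<le> \<phi> y" for y using I[of y] by simp
  have "W x \<bullet> h = f h" for h
  proof (rule ccontr)
    define g where "g = W x \<bullet> h - f h"
    \<comment> \<open>The step \<open>- (g / q)\<close> along \<open>h\<close> would lower \<phi> by
      at least \<open>g\<^sup>2 / (2 * q)\<close>. The added 1 keeps \<open>q\<close> positive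
      without a case distinction on \<open>h\<close>.\<close>
    define q where "q = wnorm_sq W h + 1"
    assume "W x \<bullet> h \<noteq> f h"
    then have g: "g\<^sup>2 > 0" by (simp add: g_def)
    have q: "q > 0" unfolding q_def using wnorm_sq_nonneg[OF W, of h] by simp
    have exp: "\<phi> (x + t *\<^sub>R h) = \<phi> x + t * g + t\<^sup>2 * wnorm_sq W h / 2" for t
      unfolding \<phi>_def g_def
      by (simp add: wnorm_sq_add[OF W] wnorm_sq_scaleR[OF W] metric_operator_on_scaleR[OF W]
          metric_operator_on_symmetric[OF W] f.add f.scaleR field_simps)
    have "0 \<le> - (g / q) * g + (g / q)\<^sup>2 * wnorm_sq W h / 2"
      using min[of "x + (- (g / q)) *\<^sub>R h"] exp[of "- (g / q)"] by simp
    also have "\<dots> \<le> - (g / q) * g + (g / q)\<^sup>2 * q / 2" unfolding q_def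
      by (intro add_left_mono divide_right_mono mult_left_mono) auto
    also have "\<dots> = - (g\<^sup>2 / (2 * q))" using q by (simp add: power2_eq_square field_simps)
    finally show False using g q by (simp add: field_simps)
  qed
  then show ?thesis by blast
qed

text \<open>\<open>x\<close> represents the functional \<open>h \<mapsto> y \<bullet> h\<close>, so
  \<open>W x - y\<close> is orthogonal to itself. This allows solving
  \<open>M i (u - z i) = y i\<close> for \<open>z i\<close>.\<close>

lemma metric_operator_surj:
  fixes W :: "'a::{real_inner, complete_space} \<Rightarrow> 'a"
  assumes W: "metric_operator_on UNIV W"
  shows "\<exists>x. W x = y"
proof -
  obtain x where "\<forall>h. W x \<bullet> h = y \<bullet> h"
    using metric_operator_representer[OF W bounded_linear_inner_right] by blast
  then have "(W x - y) \<bullet> (W x - y) = 0" by (simp add: inner_diff_left)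
  then show ?thesis by auto
qed

text \<open>\<open>adjoint\<close> is defined by choice, so its characteristic identity holds once
  some adjoint exists; Riesz representation supplies one on a complete domain.\<close>

lemma adjoint_inner:
  fixes L :: "'a::{real_inner, complete_space} \<Rightarrow> 'b::real_inner"
  assumes L: "bounded_linear L"
  shows "x \<bullet> adjoint L y = L x \<bullet> y"
proof -
  have "\<exists>w. \<forall>x. L x \<bullet> y = x \<bullet> w" for y
    using metric_operator_representer[OF metric_operator_id,
        OF bounded_linear_compose[OF bounded_linear_inner_left L], of y]
    by (metis inner_commute)
  then have "\<exists>L'. \<forall>x y. L x \<bullet> y = x \<bullet> L' y" by metis
  then have "\<forall>x y. L x \<bullet> y = x \<bullet> adjoint L y" unfolding adjoint_def by (rule someI_ex)
  then show ?thesis by simp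
qed

section \<open>Young's inequality and the relaxation of one component\<close>

text \<open>Young's inequality with the weight chosen so that \<open>r * (norm x)\<^sup>2\<close>
  cancels a cocoercivity bound with constant \<open>r\<close>. The remainder is the source of the
  terms \<open>1 / (4 * \<beta>)\<close> and \<open>1 / (4 * \<nu>)\<close>.\<close>

lemma inner_cross_ge:
  fixes x y :: "'a::real_inner"
  assumes "0 < r"
  shows "- (r * (norm x)\<^sup>2 + (norm y)\<^sup>2 / (4 * r)) \<le> x \<bullet> y"
proof -
  have "0 \<le> (2 * r * norm x - norm y)\<^sup>2 / (4 * r)" using assms by simp
  also have "\<dots> = r * (norm x)\<^sup>2 - norm x * norm y + (norm y)\<^sup>2 / (4 * r)"
    using assms by (simp add: power2_eq_square field_simps)
  finally show ?thesis using Cauchy_Schwarz_ineq2[of x y] by linarith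
qed

text \<open>
  Applied to a single component of \<open>(z, s)\<close>: \<open>c\<close> is its error constant and \<open>q\<close> the difference
  of two unrelaxed residuals.
\<close>

lemma relaxation_descent:
  assumes W: "metric_operator_on K W" and K: "subspace K" and x: "x \<in> K" "q \<in> K"
    and \<alpha>: "loewner_ge_on K W \<alpha>" "0 < \<alpha>" and c: "0 \<le> c" and \<theta>: "0 < \<theta>"
    and \<xi>: "\<xi> \<le> 2 / \<theta> * (1 - 1 / \<alpha> * c)"
  shows "1 / \<theta> * wnorm_sq W (x - \<theta> *\<^sub>R q) + (\<xi> - 1) * (1 / \<theta> * wnorm_sq W (\<theta> *\<^sub>R q))
    \<le> 1 / \<theta> * wnorm_sq W x - 2 * ((x - q) \<bullet> W q + c * (norm q)\<^sup>2)"
proof -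
  have q': "(- \<theta>) *\<^sub>R q \<in> K" using K x(2) by (rule subspace_scale)
  have "\<alpha> * (norm q)\<^sup>2 \<le> wnorm_sq W q"
    using \<alpha>(1) x(2) unfolding loewner_ge_on_def wnorm_sq_def
    by (auto simp: inner_diff_right power2_norm_eq_inner)
  \<comment> \<open>The error is measured in the plain norm; the lower bound \<alpha> on
    \<open>W\<close> converts it to the metric.\<close>
  then have "c * (norm q)\<^sup>2 \<le> c * (1 / \<alpha> * wnorm_sq W q)"
    using \<alpha>(2) c by (intro mult_left_mono) (auto simp: field_simps)
  moreover have "\<xi> * (\<theta> * wnorm_sq W q) \<le> (2 / \<theta> * (1 - 1 / \<alpha> * c)) * (\<theta> * wnorm_sq W q)"
    using \<theta> wnorm_sq_nonneg[OF W x(2)] by (intro mult_right_mono[OF \<xi>]) simp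
  moreover have "(2 / \<theta> * (1 - 1 / \<alpha> * c)) * (\<theta> * wnorm_sq W q)
      = 2 * wnorm_sq W q - 2 * (c * (1 / \<alpha> * wnorm_sq W q))"
    using \<theta> by (simp add: field_simps)
  moreover have "wnorm_sq W (x - \<theta> *\<^sub>R q) = wnorm_sq W x - 2 * \<theta> * (x \<bullet> W q) + \<theta>\<^sup>2 * wnorm_sq W q"
    using wnorm_sq_add[OF W x(1) q'] wnorm_sq_scaleR[OF W x(2), of "- \<theta>"]
      metric_operator_on_scaleR[OF W x(2), of "- \<theta>"] by simp
  \<comment> \<open>The weight \<open>1 / \<theta>\<close> frees the mixed term of \<theta>. This is
    why components with different relaxation parameters can be added.\<close>
  then have "1 / \<theta> * wnorm_sq W (x - \<theta> *\<^sub>R q)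
      = 1 / \<theta> * wnorm_sq W x - 2 * (x \<bullet> W q) + \<theta> * wnorm_sq W q"
    using \<theta> by (simp add: field_simps power2_eq_square)
  moreover have "(\<xi> - 1) * (1 / \<theta> * wnorm_sq W (\<theta> *\<^sub>R q)) = \<xi> * (\<theta> * wnorm_sq W q) - \<theta> * wnorm_sq W q"
    using \<theta> by (simp add: wnorm_sq_scaleR[OF W x(2)] power2_eq_square left_diff_distrib)
  moreover have "(x - q) \<bullet> W q = x \<bullet> W q - wnorm_sq W q"
    by (simp add: inner_diff_left wnorm_sq_def)
  ultimately show ?thesis unfolding distrib_left by linarith
qed

text \<open>Both the last hypothesis and the second conclusion rearrange
  \<open>2 * c < (2 - \<theta>) * \<alpha>\<close>. With \<open>c\<close> the error constant of a
  component, this turns the step size conditions into \<open>\<xi> > 1\<close>.\<close>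

lemma relaxation_factor_gt_1:
  fixes \<alpha> c \<theta> :: real
  assumes "0 < \<theta>" "\<theta> < 2" "0 \<le> c" "\<alpha> > 1 / (2 - \<theta>) * (2 * c)"
  shows "0 < \<alpha>" "1 < 2 / \<theta> * (1 - 1 / \<alpha> * c)"
proof -
  have "0 \<le> 1 / (2 - \<theta>) * (2 * c)" using assms by simp
  then show \<alpha>: "0 < \<alpha>" using assms(4) by linarith
  have "2 * c < (2 - \<theta>) * \<alpha>" using assms by (simp add: field_simps)
  then have "c / \<alpha> < 1 - \<theta> / 2" using \<alpha> by (simp add: field_simps)
  then have "2 / \<theta> * (\<theta> / 2) < 2 / \<theta> * (1 - 1 / \<alpha> * c)"
    using assms(1) by (intro mult_strict_left_mono) auto
  then show "1 < 2 / \<theta> * (1 - 1 / \<alpha> * c)" using assms(1) by simp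
qed

lemma monotone_operatorD:
  "monotone_operator A \<Longrightarrow> v \<in> A x \<Longrightarrow> w \<in> A y \<Longrightarrow> 0 \<le> (x - y) \<bullet> (v - w)"
  unfolding monotone_operator_def by blast

section \<open>Recursion along a rooted tree\<close>

text \<open>Children lie one level deeper than their parent, so iterating the right-hand side more
  often than the tree is deep reaches a fixed point.\<close>

lemma tree_recursion:
  fixes g :: "nat \<Rightarrow> 'a::ab_group_add"
  assumes tree: "rooted_tree n pa"
  shows "\<exists>y. \<forall>i. y i = g i + (\<Sum>c\<in>children n pa i. y c)"
proof -
  \<comment> \<open>The depth of a node. The least exponent is taken because \<open>pa 0\<close> is
    arbitrary, so the root may be met again later.\<close>
  define dep where "dep i = (LEAST k. (pa ^^ k) i = 0)" for i
  have dep: "dep c = Suc (dep (pa c))" if c: "c \<in> {1..<n}" for c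
  proof -
    obtain k where "(pa ^^ k) c = 0" using tree c unfolding rooted_tree_def by blast
    then have "dep c = Suc (LEAST k. (pa ^^ Suc k) c = 0)"
      unfolding dep_def using c by (intro Least_Suc) auto
    then show ?thesis unfolding dep_def by (simp add: funpow_swap1)
  qed
  define H where "H = Max (dep ` {..<n})"
  have H: "dep c \<le> H" if "c < n" for c unfolding H_def using that by (intro Max_ge) auto
  define F where "F y i = g i + (\<Sum>c\<in>children n pa i. y c)" for y i
  have F: "(F ^^ Suc t) w i = g i + (\<Sum>c\<in>children n pa i. (F ^^ t) w c)" for t w i
    by (simp add: F_def[of "(F ^^ t) w"])
  \<comment> \<open>\<open>t\<close> iterations of \<open>F\<close> are exact at depth greater than \<open>H - t\<close>.\<close>
  have stable: "(F ^^ Suc t) (\<lambda>_. 0) i = (F ^^ t) (\<lambda>_. 0) i" if "i < n" "t + dep i > H" for t i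
    using that
  proof (induction t arbitrary: i)
    case 0
    then show ?case using H[of i] by simp
  next
    case (Suc t)
    have "(\<Sum>c\<in>children n pa i. (F ^^ Suc t) (\<lambda>_. 0) c) = (\<Sum>c\<in>children n pa i. (F ^^ t) (\<lambda>_. 0) c)"
    proof (rule sum.cong[OF refl])
      fix c assume "c \<in> children n pa i"
      then show "(F ^^ Suc t) (\<lambda>_. 0) c = (F ^^ t) (\<lambda>_. 0) c"
        using Suc.prems dep[of c] by (intro Suc.IH) (auto simp: children_def)
    qed
    then show ?case unfolding F[of "Suc t"] F[of t "\<lambda>_. 0" i] by simp
  qed
  \<comment> \<open>After \<open>Suc H\<close> iterations all nodes are stable, whatever their
    depth. The outer \<open>F\<close> makes the equation hold also at indices that are not
    nodes.\<close>
  define y where "y = F ((F ^^ Suc H) (\<lambda>_. 0))"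
  have "y i = F y i" for i
  proof -
    have "(\<Sum>c\<in>children n pa i. y c) = (\<Sum>c\<in>children n pa i. (F ^^ Suc H) (\<lambda>_. 0) c)"
    proof (rule sum.cong[OF refl])
      fix c assume "c \<in> children n pa i"
      then show "y c = (F ^^ Suc H) (\<lambda>_. 0) c"
        unfolding y_def using stable[of c "Suc H"] by (auto simp: children_def)
    qed
    then show ?thesis by (simp add: y_def F_def)
  qed
  then show ?thesis unfolding F_def by blast
qed

section \<open>Problem data, index sets and sums over the edges of the tree\<close>

locale tree_splitting =
  fixes n m p :: nat
    and K :: "nat \<Rightarrow> 'k::{real_inner, complete_space} set"
    and A :: "nat \<Rightarrow> 'h::{real_inner, complete_space} \<Rightarrow> 'h set"
    and B D :: "nat \<Rightarrow> 'k \<Rightarrow> 'k set"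
    and C :: "nat \<Rightarrow> 'h \<Rightarrow> 'h"
    and L :: "nat \<Rightarrow> 'h \<Rightarrow> 'k"
    and a :: 'h and b :: "nat \<Rightarrow> 'k"
    and \<nu> :: "nat \<Rightarrow> ereal" and \<beta> :: "nat \<Rightarrow> real"
    and pa :: "nat \<Rightarrow> nat" and J P Jc :: "nat \<Rightarrow> nat set"
    and M :: "nat \<Rightarrow> 'h \<Rightarrow> 'h" and N :: "nat \<Rightarrow> 'k \<Rightarrow> 'k"
  assumes n: "n \<ge> 2"
    and K: "\<And>j. j \<in> {1..m} \<Longrightarrow> subspace (K j)"
    and A: "\<And>i. i < n \<Longrightarrow> monotone_operator (A i)"
    and B: "\<And>j. j \<in> {1..m} \<Longrightarrow> maximally_monotone_on (K j) (B j)"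
    and D: "\<And>j. j \<in> {1..m} \<Longrightarrow> strong_monotonicity_constant (K j) (\<nu> j) (D j)"
    and C: "\<And>l. l \<in> {1..p} \<Longrightarrow> 0 < \<beta> l \<and> cocoercive (\<beta> l) (C l)"
    and L: "\<And>j. j \<in> {1..m} \<Longrightarrow> bounded_linear (L j)"
    and tree: "rooted_tree n pa"
    and J: "indexed_partition {..<n} J {1..m}"
    and J_leaf: "\<And>i. i < n \<Longrightarrow> children n pa i = {} \<Longrightarrow> J i = {}"
    and P: "indexed_partition {..<n} P {1..p}"
    and P_root: "P 0 = {}"
    and Jc: "\<And>r. r < n \<Longrightarrow> children n pa r \<noteq> {} \<Longrightarrow>
               indexed_partition (children n pa r) Jc (J r)"
    and M: "\<And>i. i \<in> {1..<n} \<Longrightarrow> metric_operator_on UNIV (M i)"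
    and N: "\<And>j. j \<in> {1..m} \<Longrightarrow> metric_operator_on (K j) (N j)"
begin

abbreviation "is_prediction \<equiv> prediction n pa J P Jc A B D C L a b M N"

lemma pa_less: "c \<in> {1..<n} \<Longrightarrow> pa c < n"
  using tree unfolding rooted_tree_def by blast

lemma J_subset: "i < n \<Longrightarrow> j \<in> J i \<Longrightarrow> j \<in> {1..m}"
  using J unfolding indexed_partition_def by blast

lemma P_subset: "i < n \<Longrightarrow> l \<in> P i \<Longrightarrow> l \<in> {1..p}"
  using P unfolding indexed_partition_def by blast

lemma finite_J: "i < n \<Longrightarrow> finite (J i)"
  using J_subset by (meson finite_atLeastAtMost finite_subset subsetI)

lemma finite_P: "i < n \<Longrightarrow> finite (P i)"
  using P_subset by (meson finite_atLeastAtMost finite_subset subsetI)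

lemma Jc_subset: "c \<in> {1..<n} \<Longrightarrow> j \<in> Jc c \<Longrightarrow> j \<in> J (pa c)"
proof -
  assume c: "c \<in> {1..<n}" and j: "j \<in> Jc c"
  then have "c \<in> children n pa (pa c)" by (simp add: children_def)
  then show "j \<in> J (pa c)"
    using Jc[OF pa_less[OF c]] j unfolding indexed_partition_def by blast
qed

lemma Jc_range: "c \<in> {1..<n} \<Longrightarrow> j \<in> Jc c \<Longrightarrow> j \<in> {1..m}"
  using Jc_subset J_subset pa_less by blast

lemma finite_Jc: "c \<in> {1..<n} \<Longrightarrow> finite (Jc c)"
  using Jc_range by (meson finite_atLeastAtMost finite_subset subsetI)

lemma sum_nodes_split: "(\<Sum>i<n. f i) = f 0 + (\<Sum>i\<in>{1..<n}. f i)"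
proof -
  have "{..<n} = insert 0 {1..<n}" using n by auto
  then show ?thesis by simp
qed

text \<open>Each node other than the root is the lower end of exactly one edge, so edges are indexed
  by \<open>c\<close> and start at \<open>pa c\<close>.\<close>

lemma sum_children:
  "(\<Sum>i<n. \<Sum>c\<in>children n pa i. f i c) = (\<Sum>c\<in>{1..<n}. f (pa c) c)"
proof -
  have "(\<Sum>i<n. \<Sum>c\<in>children n pa i. f i c)
      = (\<Sum>i<n. \<Sum>c | c \<in> {1..<n} \<and> pa c = i. f (pa c) c)"
    by (intro sum.cong) (auto simp: children_def)
  also have "\<dots> = (\<Sum>c\<in>{1..<n}. f (pa c) c)"
    by (intro sum.group) (use pa_less in auto)
  finally show ?thesis .
qed

text \<open>The sets \<open>Jc c\<close> of the children of a node partition its dual indices, which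
  assigns each dual index to one edge. At a leaf both sides vanish because \<open>J\<close> is empty
  there.\<close>

lemma sum_J: "(\<Sum>i<n. \<Sum>j\<in>J i. f i j) = (\<Sum>c\<in>{1..<n}. \<Sum>j\<in>Jc c. f (pa c) j)"
proof -
  have "(\<Sum>j\<in>J i. f i j) = (\<Sum>c\<in>children n pa i. \<Sum>j\<in>Jc c. f i j)" if i: "i < n" for i
  proof (cases "children n pa i = {}")
    case False
    then have *: "disjoint_family_on Jc (children n pa i)" "(\<Union>c\<in>children n pa i. Jc c) = J i"
      using Jc[OF i] unfolding indexed_partition_def by auto
    show ?thesis unfolding *(2)[symmetric]
      by (rule sum.UNION_disjoint_family[OF _ _ *(1)]) (auto simp: children_def finite_Jc)
  qed (use J_leaf[OF i] in simp)
  then have "(\<Sum>i<n. \<Sum>j\<in>J i. f i j) = (\<Sum>i<n. \<Sum>c\<in>children n pa i. \<Sum>j\<in>Jc c. f i j)"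
    by simp
  then show ?thesis by (simp add: sum_children)
qed

lemma sum_duals: "(\<Sum>j\<in>{1..m}. f j) = (\<Sum>i<n. \<Sum>j\<in>J i. f j)"
  using J unfolding indexed_partition_def
  by (metis sum.UNION_disjoint_family finite_lessThan finite_J lessThan_iff)

lemma sum_cocoercive: "(\<Sum>l\<in>{1..p}. f l) = (\<Sum>i<n. \<Sum>l\<in>P i. f l)"
  using P unfolding indexed_partition_def
  by (metis sum.UNION_disjoint_family finite_lessThan finite_P lessThan_iff)

section \<open>Estimates for a single dual, cocoercive or coupling term\<close>

text \<open>\<open>B j\<close> is monotone at the new points \<open>t\<close>, but the inverse of
  \<open>D j\<close> is evaluated at the old points \<open>s\<close>. Young's inequality pays for
  this mismatch with the squared norm of the residual difference.\<close>

lemma dual_estimate: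
  assumes j: "j \<in> {1..m}" and s: "s \<in> K j" "s' \<in> K j"
    and p: "0 \<in> op_inverse (B j) t + {N j (t - s)} + op_inverse (D j) s + {b j - L j u}"
    and p': "0 \<in> op_inverse (B j) t' + {N j (t' - s')} + op_inverse (D j) s' + {b j - L j u'}"
  shows "t \<in> K j \<and> t' \<in> K j \<and>
    0 \<le> (t - t') \<bullet> L j (u - u') + (t - t') \<bullet> N j ((s - t) - (s' - t'))
       + real_of_ereal (1 / \<nu> j) / 4 * (norm ((s - t) - (s' - t')))\<^sup>2"
proof -
  note sub = K[OF j]
  obtain v w where v: "t \<in> B j v" "s \<in> D j w" "L j u = v + N j (t - s) + w + b j"
    using p unfolding op_inverse_def set_plus_def by (auto simp: algebra_simps)
  obtain v' w' where v': "t' \<in> B j v'" "s' \<in> D j w'" "L j u' = v' + N j (t' - s') + w' + b j"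
    using p' unfolding op_inverse_def set_plus_def by (auto simp: algebra_simps)
  have t: "t \<in> K j" "t' \<in> K j" using B[OF j] v(1) v'(1)
    unfolding maximally_monotone_on_def graph_of_def by auto
  define e where "e = (s - t) - (s' - t')"
  have "0 \<le> (v - v') \<bullet> (t - t')" using B[OF j] v(1) v'(1)
    unfolding maximally_monotone_on_def monotone_operator_def by blast
  moreover have "N j e = N j (t' - s') - N j (t - s)"
    using metric_operator_on_diff[OF N[OF j] sub, of "t' - s'" "t - s"] t s
    by (simp add: e_def subspace_diff[OF sub] algebra_simps)
  moreover have "L j (u - u') = L j u - L j u'"
    using L[OF j] by (simp add: bounded_linear.linear linear_diff)
  ultimately have 1: "0 \<le> (t - t') \<bullet> L j (u - u') + (t - t') \<bullet> N j e - (t - t') \<bullet> (w - w')"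
    unfolding v(3) v'(3) by (simp add: inner_add_right inner_diff_right inner_commute)
  have "- (real_of_ereal (1 / \<nu> j) / 4 * (norm e)\<^sup>2) \<le> (t - t') \<bullet> (w - w')"
  proof (cases "\<nu> j = \<infinity>")
    case True
    \<comment> \<open>The normal cone operator of \<open>{0}\<close> has values only at 0, and
      \<open>real_of_ereal (1 / \<infinity>)\<close> is 0, so the error term vanishes as
      well.\<close>
    then have "w = 0" "w' = 0" using D[OF j] v(2) v'(2)
      unfolding strong_monotonicity_constant_def normal_cone_on_def by (auto split: if_splits)
    with True show ?thesis by simp
  next
    case False
    then obtain r where r: "\<nu> j = ereal r" "0 < r"
      using D[OF j] unfolding strong_monotonicity_constant_def by (cases "\<nu> j") auto
    have "r * (norm (w - w'))\<^sup>2 \<le> (w - w') \<bullet> (s - s')"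
      using D[OF j] r v(2) v'(2)
      unfolding strong_monotonicity_constant_def strongly_monotone_def by auto
    moreover have "- (r * (norm (w - w'))\<^sup>2 + (norm (- e))\<^sup>2 / (4 * r)) \<le> (w - w') \<bullet> (- e)"
      by (rule inner_cross_ge[OF r(2)])
    moreover have "(t - t') \<bullet> (w - w') = (w - w') \<bullet> (s - s') + (w - w') \<bullet> (- e)"
      by (simp add: e_def inner_commute inner_diff_left inner_diff_right)
    moreover have "(norm (- e))\<^sup>2 / (4 * r) = real_of_ereal (1 / \<nu> j) / 4 * (norm e)\<^sup>2"
      using r by (simp add: one_ereal_def)
    ultimately show ?thesis by linarith
  qed
  with 1 t show ?thesis unfolding e_def[symmetric] by simp
qed

text \<open>\<open>C l\<close> is evaluated at the parent's points \<open>v\<close>,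
  \<open>v'\<close> but tested against the node's own points \<open>u\<close>, \<open>u'\<close>.
  Cocoercivity absorbs the quadratic term that Young's inequality creates.\<close>

lemma cocoercive_estimate:
  assumes l: "l \<in> {1..p}"
  shows "- (1 / \<beta> l / 4 * (norm ((v - v') - (u - u')))\<^sup>2) \<le> (u - u') \<bullet> (C l v - C l v')"
proof -
  let ?d = "(v - v') - (u - u')" and ?y = "C l v - C l v'"
  have \<beta>: "0 < \<beta> l" "\<beta> l * (norm ?y)\<^sup>2 \<le> (v - v') \<bullet> ?y"
    using C[OF l] unfolding cocoercive_def by auto
  moreover have "- (\<beta> l * (norm ?y)\<^sup>2 + (norm (- ?d))\<^sup>2 / (4 * \<beta> l)) \<le> ?y \<bullet> (- ?d)"
    by (rule inner_cross_ge[OF \<beta>(1)])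
  moreover have "(u - u') \<bullet> ?y = (v - v') \<bullet> ?y + ?y \<bullet> (- ?d)"
    by (simp add: inner_commute inner_diff_left inner_diff_right)
  moreover have "(norm (- ?d))\<^sup>2 / (4 * \<beta> l) = 1 / \<beta> l / 4 * (norm ?d)\<^sup>2"
    unfolding norm_minus_cancel by simp
  ultimately show ?thesis by linarith
qed

text \<open>Young's inequality with the free weight \<tau>, which distributes the cost of
  \<open>L j\<close> between the primal constant \<tau>bar and the dual constant.\<close>

lemma coupling_estimate:
  assumes j: "j \<in> {1..m}" and \<tau>: "0 < \<tau>"
  shows "- (\<tau> * (norm d)\<^sup>2 + (onorm (L j))\<^sup>2 / (4 * \<tau>) * (norm e)\<^sup>2) \<le> L j d \<bullet> e"
proof -
  have "\<bar>L j d \<bullet> e\<bar> \<le> onorm (L j) * norm d * norm e"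
    using Cauchy_Schwarz_ineq2[of "L j d" e] onorm[OF L[OF j], of d]
    by (meson mult_right_mono norm_ge_zero order_trans)
  moreover have "0 \<le> (2 * \<tau> * norm d - onorm (L j) * norm e)\<^sup>2 / (4 * \<tau>)" using \<tau> by simp
  moreover have "(2 * \<tau> * norm d - onorm (L j) * norm e)\<^sup>2 / (4 * \<tau>)
    = \<tau> * (norm d)\<^sup>2 - onorm (L j) * norm d * norm e + (onorm (L j))\<^sup>2 / (4 * \<tau>) * (norm e)\<^sup>2"
    using \<tau> by (simp add: power2_eq_square field_simps)
  ultimately show ?thesis by linarith
qed


section \<open>Monotonicity at the nodes and along one edge\<close>

text \<open>The free summands \<open>r\<close> and \<open>q\<close> let one formula serve the root,
  where both are 0, and all other nodes.\<close>

lemma node_inner: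
  assumes i: "i < n"
  shows "x \<bullet> (r + (\<Sum>c\<in>children n pa i. M c (v - z c)) + q
      + (\<Sum>j\<in>J i. adjoint (L j) (s j)))
    = x \<bullet> r + (\<Sum>c\<in>children n pa i. x \<bullet> M c (v - z c)) + x \<bullet> q
      + (\<Sum>j\<in>J i. L j x \<bullet> s j)"
proof -
  have "(\<Sum>j\<in>J i. x \<bullet> adjoint (L j) (s j)) = (\<Sum>j\<in>J i. L j x \<bullet> s j)"
    by (rule sum.cong) (use J_subset[OF i] adjoint_inner[OF L] in auto)
  then show ?thesis by (simp add: inner_add_right inner_sum_right)
qed

lemma metric_inner_diff:
  assumes "c \<in> {1..<n}"
  shows "x \<bullet> M c v - x \<bullet> M c v' = x \<bullet> M c (v - v')"
  using metric_operator_on_diff[OF M[OF assms], of v v'] by (simp add: inner_diff_right)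

lemma children_inner_diff:
  "(\<Sum>c\<in>children n pa i. x \<bullet> M c (v - z c)) - (\<Sum>c\<in>children n pa i. x \<bullet> M c (v' - z' c))
    = (\<Sum>c\<in>children n pa i. x \<bullet> M c (v - v' - (z c - z' c)))"
  unfolding sum_subtractf[symmetric]
proof (rule sum.cong[OF refl])
  fix c assume "c \<in> children n pa i"
  then have "c \<in> {1..<n}" by (simp add: children_def)
  from metric_inner_diff[OF this, of x "v - z c" "v' - z' c"]
  show "x \<bullet> M c (v - z c) - x \<bullet> M c (v' - z' c) = x \<bullet> M c (v - v' - (z c - z' c))"
    by (simp add: algebra_simps)
qed

text \<open>Monotonicity of \<open>A i\<close> between two runs: the inclusions say that
  \<open>- R\<close> is a value of \<open>A i\<close> at \<open>u i\<close>, and differences pass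
  through the linear \<open>M\<close>.\<close>

lemma node_estimate:
  assumes i: "i \<in> {1..<n}"
    and p: "is_prediction z s u zt st" and p': "is_prediction z' s' u' zt' st'"
  defines "du \<equiv> \<lambda>i. u i - u' i" and "dz \<equiv> \<lambda>i. z i - z' i" and "ds \<equiv> \<lambda>j. s j - s' j"
    and "dst \<equiv> \<lambda>j. st j - st' j"
  shows "du i \<bullet> M i (du i + dz i - 2 *\<^sub>R du (pa i)) + (\<Sum>c\<in>children n pa i. du i \<bullet> M c (du i - dz c))
    + (\<Sum>l\<in>P i. du i \<bullet> (C l (u (pa i)) - C l (u' (pa i)))) + (\<Sum>j\<in>J i. L j (du i) \<bullet> ds j)
    + (\<Sum>j\<in>Jc i. L j (du i) \<bullet> (dst j - ds j)) \<le> 0"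
proof -
  define R where "R z s u st = M i (u i + z i - 2 *\<^sub>R u (pa i))
      + (\<Sum>c\<in>children n pa i. M c (u i - z c)) + (\<Sum>l\<in>P i. C l (u (pa i)))
      + (\<Sum>j\<in>J i. adjoint (L j) (s j)) + (\<Sum>j\<in>Jc i. adjoint (L j) (st j - s j))"
    for z u :: "nat \<Rightarrow> 'h" and s st :: "nat \<Rightarrow> 'k"
  have "0 \<in> A i (u i) + {R z s u st}" "0 \<in> A i (u' i) + {R z' s' u' st'}"
    using p p' i unfolding prediction_def R_def by blast+
  then have "- R z s u st \<in> A i (u i)" "- R z' s' u' st' \<in> A i (u' i)"
    unfolding set_plus_def by (auto simp: eq_neg_iff_add_eq_0[symmetric])
  then have "0 \<le> du i \<bullet> (- R z s u st - (- R z' s' u' st'))"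
    unfolding du_def using A[of i] i by (intro monotone_operatorD) auto
  then have "du i \<bullet> R z s u st - du i \<bullet> R z' s' u' st' \<le> 0"
    by (simp add: inner_diff_right)
  moreover have "du i \<bullet> R z s u st = du i \<bullet> M i (u i + z i - 2 *\<^sub>R u (pa i))
      + (\<Sum>c\<in>children n pa i. du i \<bullet> M c (u i - z c)) + (\<Sum>l\<in>P i. du i \<bullet> C l (u (pa i)))
      + (\<Sum>j\<in>J i. L j (du i) \<bullet> s j) + (\<Sum>j\<in>Jc i. L j (du i) \<bullet> (st j - s j))"
    for z u :: "nat \<Rightarrow> 'h" and s st :: "nat \<Rightarrow> 'k"
  proof -
    have "(\<Sum>j\<in>Jc i. du i \<bullet> adjoint (L j) (st j - s j)) = (\<Sum>j\<in>Jc i. L j (du i) \<bullet> (st j - s j))"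
      by (rule sum.cong) (use Jc_range[OF i] adjoint_inner[OF L] in auto)
    then show ?thesis unfolding R_def
      using i by (simp only: node_inner inner_add_right[of _ _ "sum _ (Jc i)"] inner_sum_right
        atLeastLessThan_iff)
  qed
  moreover have "du i \<bullet> M i (u i + z i - 2 *\<^sub>R u (pa i)) - du i \<bullet> M i (u' i + z' i - 2 *\<^sub>R u' (pa i))
      = du i \<bullet> M i (du i + dz i - 2 *\<^sub>R du (pa i))"
    unfolding metric_inner_diff[OF i] by (simp add: du_def dz_def algebra_simps)
  moreover have "(\<Sum>c\<in>children n pa i. du i \<bullet> M c (u i - z c))
      - (\<Sum>c\<in>children n pa i. du i \<bullet> M c (u' i - z' c))
      = (\<Sum>c\<in>children n pa i. du i \<bullet> M c (du i - dz c))"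
    unfolding du_def dz_def by (rule children_inner_diff)
  ultimately show ?thesis
    by (simp add: inner_diff_right sum_subtractf ds_def dst_def)
qed

text \<open>The same argument for the root inclusion; \<open>a\<close> cancels in the difference of
  the two runs.\<close>

lemma root_estimate:
  assumes p: "is_prediction z s u zt st" and p': "is_prediction z' s' u' zt' st'"
  defines "du \<equiv> \<lambda>i. u i - u' i" and "dz \<equiv> \<lambda>i. z i - z' i" and "ds \<equiv> \<lambda>j. s j - s' j"
  shows "(\<Sum>c\<in>children n pa 0. du 0 \<bullet> M c (du 0 - dz c)) + (\<Sum>j\<in>J 0. L j (du 0) \<bullet> ds j) \<le> 0"
proof -
  define R where "R z s u = (\<Sum>c\<in>children n pa 0. M c (u 0 - z c))
      + (\<Sum>j\<in>J 0. adjoint (L j) (s j))" for z u :: "nat \<Rightarrow> 'h" and s :: "nat \<Rightarrow> 'k"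
  have "0 \<in> A 0 (u 0) + {R z s u - a}" "0 \<in> A 0 (u' 0) + {R z' s' u' - a}"
    using p p' unfolding prediction_def R_def by blast+
  then have "- (R z s u - a) \<in> A 0 (u 0)" "- (R z' s' u' - a) \<in> A 0 (u' 0)"
    unfolding set_plus_def by (auto simp: eq_neg_iff_add_eq_0[symmetric])
  then have "0 \<le> du 0 \<bullet> (- (R z s u - a) - (- (R z' s' u' - a)))"
    unfolding du_def using A[of 0] n by (intro monotone_operatorD) auto
  then have "du 0 \<bullet> R z s u - du 0 \<bullet> R z' s' u' \<le> 0"
    by (simp add: inner_diff_right)
  moreover have "du 0 \<bullet> R z s u = (\<Sum>c\<in>children n pa 0. du 0 \<bullet> M c (u 0 - z c))
      + (\<Sum>j\<in>J 0. L j (du 0) \<bullet> s j)" for z u :: "nat \<Rightarrow> 'h" and s :: "nat \<Rightarrow> 'k"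
    unfolding R_def using node_inner[of 0 "du 0" 0 "u 0" z 0 s] n by simp
  moreover have "(\<Sum>c\<in>children n pa 0. du 0 \<bullet> M c (u 0 - z c))
      - (\<Sum>c\<in>children n pa 0. du 0 \<bullet> M c (u' 0 - z' c))
      = (\<Sum>c\<in>children n pa 0. du 0 \<bullet> M c (du 0 - dz c))"
    unfolding du_def dz_def by (rule children_inner_diff)
  ultimately show ?thesis
    by (simp add: inner_diff_right sum_subtractf ds_def)
qed

lemma prediction_dual:
  assumes "is_prediction z s u zt st" "i < n" "j \<in> J i"
  shows "0 \<in> op_inverse (B j) (st j) + {N j (st j - s j)} + op_inverse (D j) (s j) + {b j - L j (u i)}"
  using assms unfolding prediction_def by blast

lemma prediction_dual_mem:
  assumes p: "is_prediction z s u zt st" and j: "j \<in> {1..m}" and s: "s j \<in> K j"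
  shows "st j \<in> K j"
proof -
  obtain i where i: "i < n" "j \<in> J i" using J j unfolding indexed_partition_def by blast
  \<comment> \<open>The run is compared with itself, only for the membership part of the
    estimate.\<close>
  show ?thesis
    using dual_estimate[OF j s s prediction_dual[OF p i] prediction_dual[OF p i]] by simp
qed

lemma prediction_primal:
  "is_prediction z s u zt st \<Longrightarrow> i \<in> {1..<n} \<Longrightarrow> zt i = z i + u i - u (pa i)"
  unfolding prediction_def by blast

text \<open>Here \<open>v\<close>, \<open>w\<close> and \<open>z\<close> stand for the differences
  of \<open>u c\<close>, \<open>u (pa c)\<close> and \<open>z c\<close>. With
  \<open>q = z + v - w\<close>, the difference of \<open>zt c\<close>, the arguments of
  \<open>M c\<close> become \<open>q - w\<close> and \<open>v - q\<close>, and symmetry cancels the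
  rest.\<close>

lemma edge_identity:
  assumes c: "c \<in> {1..<n}"
  shows "v \<bullet> M c (v + z - 2 *\<^sub>R w) + w \<bullet> M c (w - z) = - ((z + v - w) \<bullet> M c (w - v))"
proof -
  have sym: "x \<bullet> M c y = y \<bullet> M c x" for x y
    using metric_operator_on_symmetric[OF M[OF c], of x y] by (simp add: inner_commute)
  have "v \<bullet> M c (q - w) + w \<bullet> M c (v - q) = - (q \<bullet> M c (w - v))" for q
    unfolding metric_inner_diff[OF c, symmetric] using sym[of w v] sym[of q v] sym[of q w] by linarith
  from this[of "z + v - w"] show ?thesis by (simp add: scaleR_2 algebra_simps)
qed

section \<open>Summation over the tree\<close>

text \<open>Without the norm terms this would be firm nonexpansiveness of the prediction map in the
  metric of the \<open>M i\<close> and \<open>N j\<close>; those terms measure its defect.\<close>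

lemma prediction_estimate:
  fixes \<tau> :: "nat \<Rightarrow> real"
  assumes p: "is_prediction z s u zt st" and p': "is_prediction z' s' u' zt' st'"
    and s: "\<And>j. j \<in> {1..m} \<Longrightarrow> s j \<in> K j" and s': "\<And>j. j \<in> {1..m} \<Longrightarrow> s' j \<in> K j"
    and \<tau>: "\<And>j. j \<in> {1..m} \<Longrightarrow> 0 < \<tau> j"
  defines "d \<equiv> \<lambda>i. (z i - zt i) - (z' i - zt' i)" and "e \<equiv> \<lambda>j. (s j - st j) - (s' j - st' j)"
  shows "0 \<le> (\<Sum>i\<in>{1..<n}. (zt i - zt' i) \<bullet> M i (d i)
         + ((\<Sum>j\<in>Jc i. \<tau> j) + 1 / 4 * (\<Sum>l\<in>P i. 1 / \<beta> l)) * (norm (d i))\<^sup>2)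
     + (\<Sum>j\<in>{1..m}. (st j - st' j) \<bullet> N j (e j)
         + ((onorm (L j))\<^sup>2 / (4 * \<tau> j) + 1 / 4 * real_of_ereal (1 / \<nu> j)) * (norm (e j))\<^sup>2)"
proof -
  define du where "du i = u i - u' i" for i
  define dz where "dz i = z i - z' i" for i
  define ds where "ds j = s j - s' j" for j
  define dst where "dst j = st j - st' j" for j
  define G where "G c l = du c \<bullet> (C l (u (pa c)) - C l (u' (pa c)))" for c l
  define \<nu>i where "\<nu>i j = real_of_ereal (1 / \<nu> j)" for j
  have d: "d c = du (pa c) - du c" if "c \<in> {1..<n}" for c
    using prediction_primal[OF p that] prediction_primal[OF p' that]
    by (simp add: d_def du_def)
  have zt: "zt c - zt' c = dz c + du c - du (pa c)" if "c \<in> {1..<n}" for c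
    using prediction_primal[OF p that] prediction_primal[OF p' that]
    by (simp add: dz_def du_def)
  have e: "e j = ds j - dst j" for j by (simp add: e_def ds_def dst_def)
  have "(\<Sum>i\<in>{1..<n}. du i \<bullet> M i (du i + dz i - 2 *\<^sub>R du (pa i))
      + (\<Sum>c\<in>children n pa i. du i \<bullet> M c (du i - dz c)) + (\<Sum>l\<in>P i. G i l)
      + (\<Sum>j\<in>J i. L j (du i) \<bullet> ds j) + (\<Sum>j\<in>Jc i. L j (du i) \<bullet> (dst j - ds j))) \<le> 0"
    by (rule sum_nonpos) (use node_estimate[OF _ p p'] in \<open>simp add: du_def dz_def ds_def dst_def G_def\<close>)
  \<comment> \<open>The root inequality supplies the terms at index 0, so that the sums over
    children and over \<open>J\<close> run over all nodes and can be regrouped by edges.\<close>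
  then have "(\<Sum>i\<in>{1..<n}. du i \<bullet> M i (du i + dz i - 2 *\<^sub>R du (pa i)))
      + (\<Sum>i<n. \<Sum>c\<in>children n pa i. du i \<bullet> M c (du i - dz c)) + (\<Sum>i\<in>{1..<n}. \<Sum>l\<in>P i. G i l)
      + (\<Sum>i<n. \<Sum>j\<in>J i. L j (du i) \<bullet> ds j)
      + (\<Sum>i\<in>{1..<n}. \<Sum>j\<in>Jc i. L j (du i) \<bullet> (dst j - ds j)) \<le> 0"
    using root_estimate[OF p p'] by (simp add: sum.distrib sum_nodes_split du_def dz_def ds_def)
  then have "(\<Sum>c\<in>{1..<n}. du c \<bullet> M c (du c + dz c - 2 *\<^sub>R du (pa c)) + du (pa c) \<bullet> M c (du (pa c) - dz c)
      + (\<Sum>l\<in>P c. G c l)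
      + (\<Sum>j\<in>Jc c. L j (du (pa c)) \<bullet> ds j + L j (du c) \<bullet> (dst j - ds j))) \<le> 0"
    unfolding sum_children sum_J by (simp add: sum.distrib ac_simps)
  moreover have "du c \<bullet> M c (du c + dz c - 2 *\<^sub>R du (pa c)) + du (pa c) \<bullet> M c (du (pa c) - dz c)
      = - ((zt c - zt' c) \<bullet> M c (d c))" if "c \<in> {1..<n}" for c
    using edge_identity[OF that] by (simp add: d[OF that] zt[OF that])
  ultimately have primal: "(\<Sum>c\<in>{1..<n}. - ((zt c - zt' c) \<bullet> M c (d c)) + (\<Sum>l\<in>P c. G c l)
      + (\<Sum>j\<in>Jc c. L j (du (pa c)) \<bullet> ds j + L j (du c) \<bullet> (dst j - ds j))) \<le> 0"
    by simp
  define X where "X c = - ((zt c - zt' c) \<bullet> M c (d c)) + (\<Sum>l\<in>P c. G c l)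
      + (\<Sum>j\<in>Jc c. L j (du (pa c)) \<bullet> ds j + L j (du c) \<bullet> (dst j - ds j))" for c
  define Y where "Y c = (zt c - zt' c) \<bullet> M c (d c)
      + ((\<Sum>j\<in>Jc c. \<tau> j) + 1 / 4 * (\<Sum>l\<in>P c. 1 / \<beta> l)) * (norm (d c))\<^sup>2" for c
  define Z where "Z j = dst j \<bullet> N j (e j)
      + ((onorm (L j))\<^sup>2 / (4 * \<tau> j) + 1 / 4 * \<nu>i j) * (norm (e j))\<^sup>2" for j
  \<comment> \<open>\<open>X c\<close> collects what monotonicity of the \<open>A i\<close> leaves
    on the edge to \<open>c\<close>, and its total is at most 0; \<open>Y c\<close> and
    \<open>Z j\<close> are the summands of the claim.\<close>
  have edge: "0 \<le> X c + (Y c + (\<Sum>j\<in>Jc c. Z j))" if c: "c \<in> {1..<n}" for c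
  proof -
    have "0 \<le> (\<Sum>l\<in>P c. G c l + 1 / \<beta> l / 4 * (norm (d c))\<^sup>2)"
    proof (rule sum_nonneg)
      fix l assume "l \<in> P c"
      then have "l \<in> {1..p}" using P_subset c by auto
      from cocoercive_estimate[OF this, of "u (pa c)" "u' (pa c)" "u c" "u' c"]
      show "0 \<le> G c l + 1 / \<beta> l / 4 * (norm (d c))\<^sup>2" by (simp add: d[OF c] G_def du_def)
    qed
    also have "\<dots> = (\<Sum>l\<in>P c. G c l) + 1 / 4 * (\<Sum>l\<in>P c. 1 / \<beta> l) * (norm (d c))\<^sup>2"
      by (simp add: sum.distrib sum_distrib_left sum_distrib_right mult.commute)
    finally have 1: "0 \<le> (\<Sum>l\<in>P c. G c l) + 1 / 4 * (\<Sum>l\<in>P c. 1 / \<beta> l) * (norm (d c))\<^sup>2" .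
    have "0 \<le> (\<Sum>j\<in>Jc c. (L j (du (pa c)) \<bullet> ds j + L j (du c) \<bullet> (dst j - ds j))
        + \<tau> j * (norm (d c))\<^sup>2 + Z j)"
    proof (rule sum_nonneg)
      fix j assume jc: "j \<in> Jc c"
      then have j: "j \<in> {1..m}" and jJ: "j \<in> J (pa c)" using Jc_range c Jc_subset by auto
      note dual = dual_estimate[OF j s[OF j] s'[OF j] prediction_dual[OF p pa_less[OF c] jJ]
          prediction_dual[OF p' pa_less[OF c] jJ], folded e_def]
      have "0 \<le> dst j \<bullet> L j (du (pa c)) + dst j \<bullet> N j (e j) + \<nu>i j / 4 * (norm (e j))\<^sup>2"
        using dual unfolding e_def dst_def du_def \<nu>i_def by simp
      moreover note coupling_estimate[OF j \<tau>[OF j], of "d c" "e j"]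
      \<comment> \<open>The contributions of \<open>L j\<close> from the parent, the dual inclusion
        and the child combine to a single product of residual differences.\<close>
      moreover have "L j (d c) \<bullet> e j = L j (du (pa c)) \<bullet> ds j - dst j \<bullet> L j (du (pa c))
          + L j (du c) \<bullet> (dst j - ds j)"
        using bounded_linear.linear[OF L[OF j]]
        by (simp add: d[OF c] e linear_diff inner_diff_left inner_diff_right inner_commute)
      ultimately show "0 \<le> (L j (du (pa c)) \<bullet> ds j + L j (du c) \<bullet> (dst j - ds j))
        + \<tau> j * (norm (d c))\<^sup>2 + Z j"
        unfolding Z_def distrib_right by linarith
    qed
    also have "\<dots> = (\<Sum>j\<in>Jc c. L j (du (pa c)) \<bullet> ds j + L j (du c) \<bullet> (dst j - ds j))
        + (\<Sum>j\<in>Jc c. \<tau> j) * (norm (d c))\<^sup>2 + (\<Sum>j\<in>Jc c. Z j)"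
      by (simp only: sum.distrib sum_distrib_right)
    finally show ?thesis using 1 unfolding X_def Y_def distrib_right[of "sum _ _"] by linarith
  qed
  have "0 \<le> (\<Sum>c\<in>{1..<n}. X c + (Y c + (\<Sum>j\<in>Jc c. Z j)))"
    by (rule sum_nonneg) (rule edge)
  also have "\<dots> = (\<Sum>c\<in>{1..<n}. X c) + ((\<Sum>c\<in>{1..<n}. Y c) + (\<Sum>j\<in>{1..m}. Z j))"
    unfolding sum_duals sum_J by (simp only: sum.distrib)
  finally show ?thesis
    using primal[folded X_def] unfolding Y_def Z_def dst_def \<nu>i_def by linarith
qed

section \<open>Fixed points from solutions\<close>

abbreviation "is_relaxed_step \<equiv> relaxed_step n m pa J P Jc K A B D C L a b M N"

text \<open>All \<open>u i\<close> are set to the solution \<open>u\<close> and \<open>s j\<close>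
  is taken from the parallel sum. The inclusions then become a recursion for
  \<open>y i = M i (u - z i)\<close> with the sum over the children on the right. Increments vanish,
  so \<theta> and \<zeta> are arbitrary.\<close>

lemma fixed_point_exists:
  assumes "solves_inclusion n m p A B D C L a b u"
  shows "\<exists>x. is_relaxed_step \<theta> \<zeta> x x"
proof -
  obtain f h where a: "a = f + h + (\<Sum>l\<in>{1..p}. C l u)" and f: "f \<in> (\<Sum>i<n. A i u)"
    and h: "h \<in> (\<Sum>j\<in>{1..m}. adjoint (L j) ` parallel_sum (B j) (D j) (L j u - b j))"
    using assms unfolding solves_inclusion_def set_plus_def by auto
  obtain v where v: "\<And>i. i < n \<Longrightarrow> v i \<in> A i u" and fv: "f = (\<Sum>i<n. v i)"
    using f by (auto simp: set_sum_alt)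
  obtain w where w: "\<forall>j\<in>{1..m}. w j \<in> adjoint (L j) ` parallel_sum (B j) (D j) (L j u - b j)"
    and hw: "h = (\<Sum>j\<in>{1..m}. w j)"
    using h unfolding set_sum_alt[OF finite_atLeastAtMost] by blast
  have "\<forall>j\<in>{1..m}. \<exists>r. r \<in> parallel_sum (B j) (D j) (L j u - b j) \<and> w j = adjoint (L j) r"
    using w by auto
  then obtain s where s: "\<And>j. j \<in> {1..m} \<Longrightarrow> s j \<in> parallel_sum (B j) (D j) (L j u - b j)"
    and ws: "\<And>j. j \<in> {1..m} \<Longrightarrow> w j = adjoint (L j) (s j)"
    unfolding bchoice_iff by blast
  have dual: "s j \<in> K j \<and> 0 \<in> op_inverse (B j) (s j) + {N j (s j - s j)} + op_inverse (D j) (s j)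
      + {b j - L j u}" if j: "j \<in> {1..m}" for j
  proof -
    obtain x y where xy: "L j u - b j = x + y" "s j \<in> B j x" "s j \<in> D j y"
      using s[OF j] unfolding parallel_sum_def op_inverse_def set_plus_def by blast
    have "0 = x + 0 + y + (b j - L j u)" using xy(1) by (simp add: algebra_simps)
    then have "0 \<in> op_inverse (B j) (s j) + {0} + op_inverse (D j) (s j) + {b j - L j u}"
      using xy(2,3) unfolding op_inverse_def set_plus_def by blast
    moreover have "N j (s j - s j) = 0" using metric_operator_on_zero[OF N[OF j] K[OF j]] by simp
    moreover have "s j \<in> K j" using B[OF j] xy(2)
      unfolding maximally_monotone_on_def graph_of_def by auto
    ultimately show ?thesis by simp
  qed
  define g where "g i = v i + (\<Sum>l\<in>P i. C l u) + (\<Sum>j\<in>J i. adjoint (L j) (s j))" for i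
  obtain y where y: "\<And>i. y i = g i + (\<Sum>c\<in>children n pa i. y c)"
    using tree_recursion[OF tree] by blast
  \<comment> \<open>Summed over all nodes, the recursion cancels every \<open>y i\<close> except that of the root.\<close>
  have "(\<Sum>i<n. y i) = (\<Sum>i<n. g i) + (\<Sum>i\<in>{1..<n}. y i)"
    by (subst y) (simp add: sum.distrib sum_children)
  then have "y 0 = (\<Sum>i<n. g i)" by (simp add: sum_nodes_split)
  also have "\<dots> = a"
    unfolding g_def sum.distrib sum_cocoercive[symmetric] sum_duals[symmetric] a fv hw
    by (simp add: ws)
  finally have y0: "y 0 = a" .
  have "\<forall>i. \<exists>x. i \<in> {1..<n} \<longrightarrow> M i x = y i" using metric_operator_surj[OF M] by blast
  then obtain x where x: "\<And>i. i \<in> {1..<n} \<Longrightarrow> M i (x i) = y i" by metis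
  define z where "z i = u - x i" for i
  have ch: "(\<Sum>c\<in>children n pa i. M c (u - z c)) = (\<Sum>c\<in>children n pa i. y c)" for i
    by (rule sum.cong) (auto simp: z_def children_def x)
  have adj0: "adjoint (L j) 0 = 0" if "j \<in> {1..m}" for j
    using adjoint_inner[OF L[OF that], of "adjoint (L j) 0" 0] by simp
  have adj: "(\<Sum>j\<in>Jc i. adjoint (L j) (s j - s j)) = 0" if "i \<in> {1..<n}" for i
    using Jc_range[OF that] adj0 by (simp add: sum.neutral)
  have Mz: "M i (u + z i - 2 *\<^sub>R u) = - y i" if i: "i \<in> {1..<n}" for i
    using metric_operator_on_scaleR[OF M[OF i], of "x i" "-1"] x[OF i]
    by (simp add: z_def scaleR_2)
  have "is_prediction z s (\<lambda>_. u) z s"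
    unfolding prediction_def
  proof (intro conjI ballI allI impI)
    \<comment> \<open>As \<open>P 0\<close> is empty, \<open>g 0\<close> has no cocoercive term, in
      agreement with the root inclusion.\<close>
    have "0 = v 0 + ((\<Sum>c\<in>children n pa 0. M c (u - z c)) + (\<Sum>j\<in>J 0. adjoint (L j) (s j)) - a)"
      using y[of 0] P_root unfolding ch y0 g_def by (simp add: algebra_simps)
    then show "0 \<in> A 0 u + {(\<Sum>c\<in>children n pa 0. M c (u - z c))
        + (\<Sum>j\<in>J 0. adjoint (L j) (s j)) - a}"
      using v[of 0] n unfolding set_plus_def by auto
  next
    fix i j assume "i < n" "j \<in> J i"
    then show "0 \<in> op_inverse (B j) (s j) + {N j (s j - s j)} + op_inverse (D j) (s j) + {b j - L j u}"
      using dual J_subset by blast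
  next
    fix i assume i: "i \<in> {1..<n}"
    let ?R = "M i (u + z i - 2 *\<^sub>R u) + (\<Sum>c\<in>children n pa i. M c (u - z c)) + (\<Sum>l\<in>P i. C l u)
        + (\<Sum>j\<in>J i. adjoint (L j) (s j)) + (\<Sum>j\<in>Jc i. adjoint (L j) (s j - s j))"
    have "0 = v i + ?R"
      using y[of i] unfolding ch Mz[OF i] adj[OF i] g_def by (simp add: algebra_simps)
    then show "0 \<in> A i u + {?R}" using v[of i] i unfolding set_plus_def by auto
  qed simp
  then have "is_relaxed_step \<theta> \<zeta> (z, s) (z, s)"
    unfolding relaxed_step_def using dual by auto
  then show ?thesis by blast
qed

section \<open>Descent of the relaxed step\<close>

lemma weighted_dist_sq_nonneg:
  assumes "\<And>i. i \<in> {1..<n} \<Longrightarrow> 0 < \<theta> i" "\<And>j. j \<in> {1..m} \<Longrightarrow> 0 < \<zeta> j"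
    and "\<And>j. j \<in> {1..m} \<Longrightarrow> s j \<in> K j" "\<And>j. j \<in> {1..m} \<Longrightarrow> s' j \<in> K j"
  shows "0 \<le> weighted_dist_sq n m M N \<theta> \<zeta> (z, s) (z', s')"
  unfolding weighted_dist_sq_def prod.case
  using assms wnorm_sq_nonneg[OF M] wnorm_sq_nonneg[OF N] subspace_diff[OF K]
  by (intro add_nonneg_nonneg sum_nonneg mult_nonneg_nonneg) (auto intro: less_imp_le)

lemma primal_constant_nonneg:
  fixes \<tau> :: "nat \<Rightarrow> real"
  assumes i: "i \<in> {1..<n}" and \<tau>: "\<And>j. j \<in> {1..m} \<Longrightarrow> 0 < \<tau> j"
  shows "0 \<le> (\<Sum>j\<in>Jc i. \<tau> j) + 1 / 4 * (\<Sum>l\<in>P i. 1 / \<beta> l)"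
proof -
  have "0 \<le> \<tau> j" if "j \<in> Jc i" for j using \<tau>[OF Jc_range[OF i that]] by simp
  moreover have "0 \<le> 1 / \<beta> l" if "l \<in> P i" for l using C[of l] P_subset[OF _ that] i by simp
  ultimately show ?thesis by (intro add_nonneg_nonneg mult_nonneg_nonneg sum_nonneg) auto
qed

lemma dual_constant_nonneg:
  assumes j: "j \<in> {1..m}" and \<tau>: "0 < \<tau>"
  shows "0 \<le> (onorm (L j))\<^sup>2 / (4 * \<tau>) + 1 / 4 * real_of_ereal (1 / \<nu> j)"
proof -
  have "0 < \<nu> j" using D[OF j] by (simp add: strong_monotonicity_constant_def)
  then have "0 \<le> real_of_ereal (1 / \<nu> j)" by (cases "\<nu> j") (simp_all add: one_ereal_def)
  with \<tau> show ?thesis by simp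
qed

text \<open>The one-component descent is applied with \<open>q\<close> equal to \<open>d i\<close>
  or \<open>e j\<close> and then summed. The subtracted terms are known to be nonnegative only in
  total, by the prediction estimate.\<close>

lemma relaxed_step_descent:
  fixes \<tau> \<alpha> \<sigma> :: "nat \<Rightarrow> real" and \<xi> :: real
  assumes step: "is_relaxed_step \<theta> \<zeta> (z, s) (y, r)" and step': "is_relaxed_step \<theta> \<zeta> (z', s') (y', r')"
    and \<theta>: "\<And>i. i \<in> {1..<n} \<Longrightarrow> 0 < \<theta> i" and \<zeta>: "\<And>j. j \<in> {1..m} \<Longrightarrow> 0 < \<zeta> j"
    and \<tau>: "\<And>j. j \<in> {1..m} \<Longrightarrow> 0 < \<tau> j"
    and \<alpha>: "\<And>i. i \<in> {1..<n} \<Longrightarrow> loewner_ge_on UNIV (M i) (\<alpha> i)" "\<And>i. i \<in> {1..<n} \<Longrightarrow> 0 < \<alpha> i"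
    and \<sigma>: "\<And>j. j \<in> {1..m} \<Longrightarrow> loewner_ge_on (K j) (N j) (\<sigma> j)" "\<And>j. j \<in> {1..m} \<Longrightarrow> 0 < \<sigma> j"
    and \<xi>: "\<And>i. i \<in> {1..<n} \<Longrightarrow>
        \<xi> \<le> 2 / \<theta> i * (1 - 1 / \<alpha> i * ((\<Sum>j\<in>Jc i. \<tau> j) + 1 / 4 * (\<Sum>l\<in>P i. 1 / \<beta> l)))"
      "\<And>j. j \<in> {1..m} \<Longrightarrow>
        \<xi> \<le> 2 / \<zeta> j * (1 - 1 / \<sigma> j * ((onorm (L j))\<^sup>2 / (4 * \<tau> j) + 1 / 4 * real_of_ereal (1 / \<nu> j)))"
  shows "weighted_dist_sq n m M N \<theta> \<zeta> (y, r) (y', r')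
      + (\<xi> - 1) * weighted_dist_sq n m M N \<theta> \<zeta>
          (\<lambda>i. z i - y i, \<lambda>j. s j - r j) (\<lambda>i. z' i - y' i, \<lambda>j. s' j - r' j)
    \<le> weighted_dist_sq n m M N \<theta> \<zeta> (z, s) (z', s')"
proof -
  obtain u zt st where p: "is_prediction z s u zt st" and s: "\<And>j. j \<in> {1..m} \<Longrightarrow> s j \<in> K j"
    and y: "\<And>i. i \<in> {1..<n} \<Longrightarrow> y i = z i + \<theta> i *\<^sub>R (zt i - z i)"
    and r: "\<And>j. j \<in> {1..m} \<Longrightarrow> r j = s j + \<zeta> j *\<^sub>R (st j - s j)"
    using step unfolding relaxed_step_def by auto
  obtain u' zt' st' where p': "is_prediction z' s' u' zt' st'" and s': "\<And>j. j \<in> {1..m} \<Longrightarrow> s' j \<in> K j"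
    and y': "\<And>i. i \<in> {1..<n} \<Longrightarrow> y' i = z' i + \<theta> i *\<^sub>R (zt' i - z' i)"
    and r': "\<And>j. j \<in> {1..m} \<Longrightarrow> r' j = s' j + \<zeta> j *\<^sub>R (st' j - s' j)"
    using step' unfolding relaxed_step_def by auto
  define d where "d i = (z i - zt i) - (z' i - zt' i)" for i
  define e where "e j = (s j - st j) - (s' j - st' j)" for j
  define c where "c i = (\<Sum>j\<in>Jc i. \<tau> j) + 1 / 4 * (\<Sum>l\<in>P i. 1 / \<beta> l)" for i
  define k where "k j = (onorm (L j))\<^sup>2 / (4 * \<tau> j) + 1 / 4 * real_of_ereal (1 / \<nu> j)" for j
  have est: "0 \<le> (\<Sum>i\<in>{1..<n}. (zt i - zt' i) \<bullet> M i (d i) + c i * (norm (d i))\<^sup>2)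
      + (\<Sum>j\<in>{1..m}. (st j - st' j) \<bullet> N j (e j) + k j * (norm (e j))\<^sup>2)"
    unfolding d_def e_def c_def k_def by (rule prediction_estimate[OF p p' s s' \<tau>])
  have primal: "1 / \<theta> i * wnorm_sq (M i) (y i - y' i)
      + (\<xi> - 1) * (1 / \<theta> i * wnorm_sq (M i) ((z i - y i) - (z' i - y' i)))
    \<le> 1 / \<theta> i * wnorm_sq (M i) (z i - z' i)
      - 2 * ((zt i - zt' i) \<bullet> M i (d i) + c i * (norm (d i))\<^sup>2)" if i: "i \<in> {1..<n}" for i
  proof -
    have "y i - y' i = (z i - z' i) - \<theta> i *\<^sub>R d i" "(z i - y i) - (z' i - y' i) = \<theta> i *\<^sub>R d i"
      "zt i - zt' i = (z i - z' i) - d i"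
      unfolding y[OF i] y'[OF i] d_def by (simp_all add: algebra_simps)
    moreover have "0 \<le> c i" unfolding c_def by (rule primal_constant_nonneg[OF i \<tau>])
    ultimately show ?thesis
      using relaxation_descent[OF M[OF i] subspace_UNIV UNIV_I UNIV_I \<alpha>(1)[OF i] \<alpha>(2)[OF i] _ \<theta>[OF i]
          \<xi>(1)[OF i, folded c_def]] by simp
  qed
  have dual: "1 / \<zeta> j * wnorm_sq (N j) (r j - r' j)
      + (\<xi> - 1) * (1 / \<zeta> j * wnorm_sq (N j) ((s j - r j) - (s' j - r' j)))
    \<le> 1 / \<zeta> j * wnorm_sq (N j) (s j - s' j)
      - 2 * ((st j - st' j) \<bullet> N j (e j) + k j * (norm (e j))\<^sup>2)" if j: "j \<in> {1..m}" for j
  proof -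
    have eqs: "r j - r' j = (s j - s' j) - \<zeta> j *\<^sub>R e j" "(s j - r j) - (s' j - r' j) = \<zeta> j *\<^sub>R e j"
      "st j - st' j = (s j - s' j) - e j"
      unfolding r[OF j] r'[OF j] e_def by (simp_all add: algebra_simps)
    have "0 \<le> k j" unfolding k_def by (rule dual_constant_nonneg[OF j \<tau>[OF j]])
    moreover have "s j - s' j \<in> K j" using s s' j subspace_diff[OF K[OF j]] by blast
    moreover have "e j \<in> K j" unfolding e_def
      using s s' j prediction_dual_mem[OF p j] prediction_dual_mem[OF p' j] subspace_diff[OF K[OF j]]
      by blast
    ultimately show ?thesis
      unfolding eqs using relaxation_descent[OF N[OF j] K[OF j] _ _ \<sigma>(1)[OF j] \<sigma>(2)[OF j] _ \<zeta>[OF j]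
          \<xi>(2)[OF j, folded k_def]] by blast
  qed
  have "(\<Sum>i\<in>{1..<n}. 1 / \<theta> i * wnorm_sq (M i) (y i - y' i)
        + (\<xi> - 1) * (1 / \<theta> i * wnorm_sq (M i) ((z i - y i) - (z' i - y' i))))
      + (\<Sum>j\<in>{1..m}. 1 / \<zeta> j * wnorm_sq (N j) (r j - r' j)
        + (\<xi> - 1) * (1 / \<zeta> j * wnorm_sq (N j) ((s j - r j) - (s' j - r' j))))
    \<le> (\<Sum>i\<in>{1..<n}. 1 / \<theta> i * wnorm_sq (M i) (z i - z' i)
        - 2 * ((zt i - zt' i) \<bullet> M i (d i) + c i * (norm (d i))\<^sup>2))
      + (\<Sum>j\<in>{1..m}. 1 / \<zeta> j * wnorm_sq (N j) (s j - s' j)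
        - 2 * ((st j - st' j) \<bullet> N j (e j) + k j * (norm (e j))\<^sup>2))"
    by (intro add_mono sum_mono primal dual)
  then show ?thesis
    using est unfolding weighted_dist_sq_def prod.case
    by (simp only: sum.distrib sum_subtractf sum_distrib_left[symmetric] distrib_left)
qed

end

section \<open>Convergence rates of the relaxed scheme\<close>

theorem proposition4p7:
  fixes n m p :: nat
    and K :: "nat \<Rightarrow> 'k::{real_inner, complete_space} set"
    and A :: "nat \<Rightarrow> 'h::{real_inner, complete_space} \<Rightarrow> 'h set"
    and B D :: "nat \<Rightarrow> 'k \<Rightarrow> 'k set"
    and C :: "nat \<Rightarrow> 'h \<Rightarrow> 'h"
    and L :: "nat \<Rightarrow> 'h \<Rightarrow> 'k"
    and a :: 'h and b :: "nat \<Rightarrow> 'k"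
    and \<nu> :: "nat \<Rightarrow> ereal" and \<beta> :: "nat \<Rightarrow> real"
    and pa :: "nat \<Rightarrow> nat" and J P Jc :: "nat \<Rightarrow> nat set"
    and M :: "nat \<Rightarrow> 'h \<Rightarrow> 'h" and N :: "nat \<Rightarrow> 'k \<Rightarrow> 'k"
    and \<theta> \<zeta> \<tau> \<alpha> \<sigma> \<tau>bar \<beta>bar_inv :: "nat \<Rightarrow> real" and \<xi> :: real
    and z :: "nat \<Rightarrow> nat \<Rightarrow> 'h" and s :: "nat \<Rightarrow> nat \<Rightarrow> 'k"
  assumes n: "n \<ge> 2"
    and K: "\<And>j. j \<in> {1..m} \<Longrightarrow> subspace (K j) \<and> closed (K j)"
    and A: "\<And>i. i < n \<Longrightarrow> maximally_monotone_on UNIV (A i)"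
    and B: "\<And>j. j \<in> {1..m} \<Longrightarrow> maximally_monotone_on (K j) (B j)"
    and D: "\<And>j. j \<in> {1..m} \<Longrightarrow> maximally_monotone_on (K j) (D j)"
    and \<nu>: "\<And>j. j \<in> {1..m} \<Longrightarrow> strong_monotonicity_constant (K j) (\<nu> j) (D j)"
    and C: "\<And>l. l \<in> {1..p} \<Longrightarrow> 0 < \<beta> l \<and> cocoercive (\<beta> l) (C l)"
    and L: "\<And>j. j \<in> {1..m} \<Longrightarrow> bounded_linear (L j) \<and> range (L j) \<subseteq> K j"
    and b: "\<And>j. j \<in> {1..m} \<Longrightarrow> b j \<in> K j"
    and solvable: "\<exists>u. solves_inclusion n m p A B D C L a b u"
    and tree: "rooted_tree n pa"
    and J: "indexed_partition {..<n} J {1..m}"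
    and J_leaf: "\<And>i. i < n \<Longrightarrow> children n pa i = {} \<Longrightarrow> J i = {}"
    and P: "indexed_partition {..<n} P {1..p}"
    and P_root: "P 0 = {}"
    and Jc: "\<And>r. r < n \<Longrightarrow> children n pa r \<noteq> {} \<Longrightarrow>
               indexed_partition (children n pa r) Jc (J r)"
    and M: "\<And>i. i \<in> {1..<n} \<Longrightarrow> metric_operator_on UNIV (M i)"
    and N: "\<And>j. j \<in> {1..m} \<Longrightarrow> metric_operator_on (K j) (N j)"
    and scheme: "\<And>k. relaxed_step n m pa J P Jc K A B D C L a b M N \<theta> \<zeta>
                        (z k, s k) (z (Suc k), s (Suc k))"
    and \<tau>: "\<And>j. j \<in> {1..m} \<Longrightarrow> 0 < \<tau> j"
    and \<tau>bar: "\<And>i. i \<in> {1..<n} \<Longrightarrow> \<tau>bar i = (\<Sum>j\<in>Jc i. \<tau> j)"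
    and \<beta>bar_inv: "\<And>i. i \<in> {1..<n} \<Longrightarrow> \<beta>bar_inv i = (\<Sum>l\<in>P i. 1 / \<beta> l)"
    and \<theta>: "\<And>i. i \<in> {1..<n} \<Longrightarrow> \<theta> i \<in> {0<..<2}"
    and \<zeta>: "\<And>j. j \<in> {1..m} \<Longrightarrow> \<zeta> j \<in> {0<..<2}"
    and \<alpha>: "\<And>i. i \<in> {1..<n} \<Longrightarrow>
               loewner_ge_on UNIV (M i) (\<alpha> i) \<and>
               \<alpha> i > 1 / (2 - \<theta> i) * (2 * \<tau>bar i + 1 / 2 * \<beta>bar_inv i)"
    and \<sigma>: "\<And>j. j \<in> {1..m} \<Longrightarrow>
               loewner_ge_on (K j) (N j) (\<sigma> j) \<and>
               \<sigma> j > 1 / (2 - \<zeta> j) *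
                 ((onorm (L j))\<^sup>2 / (2 * \<tau> j) + 1 / 2 * real_of_ereal (1 / \<nu> j))"
    and \<xi>: "\<xi> = Min
      ((\<lambda>i. 2 / \<theta> i * (1 - 1 / \<alpha> i * (\<tau>bar i + 1 / 4 * \<beta>bar_inv i))) ` {1..<n} \<union>
       (\<lambda>j. 2 / \<zeta> j * (1 - 1 / \<sigma> j *
              ((onorm (L j))\<^sup>2 / (4 * \<tau> j) + 1 / 4 * real_of_ereal (1 / \<nu> j)))) ` {1..m})"
  shows "(\<lambda>k. weighted_dist_sq n m M N \<theta> \<zeta> (z k, s k) (z (Suc k), s (Suc k)))
           \<in> o(\<lambda>k. 1 / real k)
    \<and> (\<forall>(zstar, sstar) \<in> relaxed_fix n m pa J P Jc K A B D C L a b M N \<theta> \<zeta>.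
         \<forall>k\<ge>1. weighted_dist_sq n m M N \<theta> \<zeta> (z k, s k) (z (Suc k), s (Suc k))
           \<le> 1 / (real k * (\<xi> - 1)) *
              weighted_dist_sq n m M N \<theta> \<zeta> (z 0, s 0) (zstar, sstar))"
proof -
  interpret tree_splitting n m p K A B D C L a b \<nu> \<beta> pa J P Jc M N
    by (rule tree_splitting.intro)
      (use n K A B \<nu> C L tree J J_leaf P P_root Jc M N in \<open>auto simp: maximally_monotone_on_def\<close>)
  let ?W = "weighted_dist_sq n m M N \<theta> \<zeta>"
  let ?c = "\<lambda>i. (\<Sum>j\<in>Jc i. \<tau> j) + 1 / 4 * (\<Sum>l\<in>P i. 1 / \<beta> l)"
  let ?k = "\<lambda>j. (onorm (L j))\<^sup>2 / (4 * \<tau> j) + 1 / 4 * real_of_ereal (1 / \<nu> j)"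
  define f where "f k = ?W (z k, s k) (z (Suc k), s (Suc k))" for k
  have \<theta>0: "\<And>i. i \<in> {1..<n} \<Longrightarrow> 0 < \<theta> i" and \<zeta>0: "\<And>j. j \<in> {1..m} \<Longrightarrow> 0 < \<zeta> j"
    using \<theta> \<zeta> by auto
  have primal: "0 < \<alpha> i" "1 < 2 / \<theta> i * (1 - 1 / \<alpha> i * ?c i)" if i: "i \<in> {1..<n}" for i
  proof -
    have "0 \<le> ?c i" by (rule primal_constant_nonneg[OF i \<tau>])
    moreover have "\<alpha> i > 1 / (2 - \<theta> i) * (2 * ?c i)"
      using \<alpha>[OF i] by (simp add: \<tau>bar[OF i] \<beta>bar_inv[OF i])
    ultimately show "0 < \<alpha> i" "1 < 2 / \<theta> i * (1 - 1 / \<alpha> i * ?c i)"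
      using \<theta>[OF i] relaxation_factor_gt_1[of "\<theta> i" "?c i" "\<alpha> i"] by auto
  qed
  have dual: "0 < \<sigma> j" "1 < 2 / \<zeta> j * (1 - 1 / \<sigma> j * ?k j)" if j: "j \<in> {1..m}" for j
  proof -
    have "0 \<le> ?k j" by (rule dual_constant_nonneg[OF j \<tau>[OF j]])
    moreover have "2 * ?k j = (onorm (L j))\<^sup>2 / (2 * \<tau> j) + 1 / 2 * real_of_ereal (1 / \<nu> j)"
      by (simp add: field_simps)
    then have "\<sigma> j > 1 / (2 - \<zeta> j) * (2 * ?k j)" using \<sigma>[OF j] by simp
    ultimately show "0 < \<sigma> j" "1 < 2 / \<zeta> j * (1 - 1 / \<sigma> j * ?k j)"
      using \<zeta>[OF j] relaxation_factor_gt_1[of "\<zeta> j" "?k j" "\<sigma> j"] by auto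
  qed
  define S where "S = (\<lambda>i. 2 / \<theta> i * (1 - 1 / \<alpha> i * ?c i)) ` {1..<n}
      \<union> (\<lambda>j. 2 / \<zeta> j * (1 - 1 / \<sigma> j * ?k j)) ` {1..m}"
  have S: "finite S" "S \<noteq> {}" using n unfolding S_def by auto
  have "\<xi> = Min S" unfolding \<xi> S_def using \<tau>bar \<beta>bar_inv
    by (intro arg_cong[where f = Min] arg_cong2[where f = "(\<union>)"] image_cong) auto
  then have \<xi>1: "1 < \<xi>" and \<xi>S: "\<And>x. x \<in> S \<Longrightarrow> \<xi> \<le> x"
    using S primal(2) dual(2) by (auto simp: S_def)
  have descent: "?W (y, r) (y', r') + (\<xi> - 1) * ?W (\<lambda>i. x i - y i, \<lambda>j. t j - r j)
        (\<lambda>i. x' i - y' i, \<lambda>j. t' j - r' j) \<le> ?W (x, t) (x', t')"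
    if "is_relaxed_step \<theta> \<zeta> (x, t) (y, r)" "is_relaxed_step \<theta> \<zeta> (x', t') (y', r')" for x t y r x' t' y' r'
    using that \<theta>0 \<zeta>0 \<tau>
  proof (rule relaxed_step_descent)
    show "\<xi> \<le> 2 / \<theta> i * (1 - 1 / \<alpha> i * ?c i)" if "i \<in> {1..<n}" for i
      by (rule \<xi>S) (use that in \<open>auto simp: S_def\<close>)
    show "\<xi> \<le> 2 / \<zeta> j * (1 - 1 / \<sigma> j * ?k j)" if "j \<in> {1..m}" for j
      by (rule \<xi>S) (use that in \<open>auto simp: S_def\<close>)
  qed (use \<alpha> \<sigma> primal(1) dual(1) in auto)
  have sK: "s k j \<in> K j" if "j \<in> {1..m}" for k j
    using scheme[of k] that unfolding relaxed_step_def by auto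
  have f0: "0 \<le> f k" for k
    unfolding f_def by (rule weighted_dist_sq_nonneg[OF \<theta>0 \<zeta>0 sK sK])
  \<comment> \<open>The scheme shifted by one step is taken as the second run: the distances before
    and after the step are then \<open>f k\<close> and \<open>f (Suc k)\<close>.\<close>
  have "f (Suc k) \<le> f k" for k
  proof -
    have "0 \<le> ?W (\<lambda>i. z k i - z (Suc k) i, \<lambda>j. s k j - s (Suc k) j)
        (\<lambda>i. z (Suc k) i - z (Suc (Suc k)) i, \<lambda>j. s (Suc k) j - s (Suc (Suc k)) j)"
      using sK subspace_diff K by (intro weighted_dist_sq_nonneg \<theta>0 \<zeta>0) blast+
    then have "0 \<le> (\<xi> - 1) * \<dots>" using \<xi>1 by simp
    with descent[OF scheme[of k] scheme[of "Suc k"]] show ?thesis unfolding f_def by linarith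
  qed
  then have dec: "decseq f" by (rule decseq_SucI)
  \<comment> \<open>The second run stays at the fixed point and has zero residual, so the difference
    of residuals is that of the iterate alone.\<close>
  have fejer: "?W (z (Suc k), s (Suc k)) (x, t) + (\<xi> - 1) * f k \<le> ?W (z k, s k) (x, t)"
    if "is_relaxed_step \<theta> \<zeta> (x, t) (x, t)" for x t k
    using descent[OF scheme[of k] that] by (simp add: f_def weighted_dist_sq_def)
  have V0: "0 \<le> ?W (z k, s k) (x, t)" if "is_relaxed_step \<theta> \<zeta> (x, t) (x, t)" for x t k
    using that by (intro weighted_dist_sq_nonneg \<theta>0 \<zeta>0 sK) (auto simp: relaxed_step_def)
  \<comment> \<open>Summability requires some fixed point to exist; solvability of the inclusion
    provides it.\<close>
  obtain u where "solves_inclusion n m p A B D C L a b u" using solvable by blast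
  then obtain x t where xt: "is_relaxed_step \<theta> \<zeta> (x, t) (x, t)"
    using fixed_point_exists[of u \<theta> \<zeta>] by (metis surj_pair)
  have "summable f"
    by (rule fejer_summable[where f = f and \<kappa> = "\<xi> - 1" and V = "\<lambda>k. ?W (z k, s k) (x, t)", OF f0 _ V0[OF xt] fejer[OF xt]]) (use \<xi>1 in simp)
  then have "f \<in> o(\<lambda>k. 1 / real k)" by (rule summable_decseq_smallo[OF f0 dec])
  moreover have "f k \<le> 1 / (real k * (\<xi> - 1)) * ?W (z 0, s 0) (x, t)"
    if "is_relaxed_step \<theta> \<zeta> (x, t) (x, t)" "k \<ge> 1" for x t k
    by (rule fejer_rate[where f = f and \<kappa> = "\<xi> - 1"
          and V = "\<lambda>k. ?W (z k, s k) (x, t)", OF dec _ V0[OF that(1)] fejer[OF that(1)] that(2)]) (use \<xi>1 in simp)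
  ultimately show ?thesis unfolding f_def[abs_def] relaxed_fix_def by auto
qed

end
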